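(* Let $\mathcal{Y}_1,\mathcal{Y}_2,\mathcal{X}$ be Polish spaces, $\mathcal{S}=\mathcal{Y}_1\times\mathcal{Y}_2\times\mathcal{X}$ and $\mathcal{S}_\ell=\mathcal{Y}_\ell\times\mathcal{X}$ for $\ell=1,2$. For $\ell=1,2$ let $\boldsymbol{d}_{\mathcal{S}_\ell}$ be a metric making $\mathcal{S}_\ell$ (with its product topology) a proper Polish metric space, let $p_\ell\ge1$, $c_\ell(s_\ell,s_\ell')=\boldsymbol{d}_{\mathcal{S}_\ell}(s_\ell,s_\ell')^{p_\ell}$, and let $\mu_{\ell3}\in\mathcal{P}_{p_\ell}(\mathcal{S}_\ell)$, where $\mu_{13}$ and $\mu_{23}$ have the same projection on $\mathcal{X}$. Let $f:\mathcal{S}\to\mathbb{R}$ be measurable with $\int_{\mathcal{S}} f\,d\nu_0>-\infty$ for some $\nu_0\in\mathcal{F}(\mu_{13},\mu_{23})$. Assume further that $f$ is upper-semicontinuous and that there exist $(s_1^\star,s_2^\star)\in\mathcal{S}_1\times\mathcal{S}_2$, with $s_\ell^\star=(y_\ell^\star,x_\ell^\star)$, a constant $M>0$ and $p_\ell'\in(0,p_\ell)$ for $\ell=1,2$ such that $$f(s)\le M\left[1+\boldsymbol{d}_{\mathcal{S}_1}(s_1^\star,s_1)^{p_1'}+\boldsymbol{d}_{\mathcal{S}_2}(s_2^\star,s_2)^{p_2'}\right]$$ for all $s=(y_1,y_2,x)\in\mathcal{S}$, where $s_\ell=(y_\ell,x)$. Then for every $\delta\in\mathbb{R}_+^2$ an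 optimal solution of $$\sup_{\gamma\in\Sigma(\delta)}\int_{\mathcal{S}} f\,d\gamma$$ exists, i.e. the supremum is attained by some $\gamma\in\Sigma(\delta)$.
   Context: A metric space is proper if all its closed balls are compact. $\mathcal{P}(\cdot)$ is the set of Borel probability measures; $\mathcal{P}_p(\mathcal{X})$ is the set of $\mu\in\mathcal{P}(\mathcal{X})$ with $\int\boldsymbol{d}(x_0,x)^p\,d\mu(x)<\infty$ for some (any) $x_0$; $\Pi(\mu,\nu)$ is the set of couplings; $\mathbb{R}_+^2$ is the set of vectors with nonnegative coordinates. For $\gamma\in\mathcal{P}(\mathcal{S})$, $\gamma_{\ell3}$ is its projection on $\mathcal{Y}_\ell\times\mathcal{X}$; $\mathcal{F}(\mu_{13},\mu_{23})=\{\gamma\in\mathcal{P}(\mathcal{S}):\gamma_{13}=\mu_{13},\gamma_{23}=\mu_{23}\}$. $\boldsymbol{K}_\ell(\mu,\nu)=\inf_{\pi\in\Pi(\mu,\nu)}\int c_\ell\,d\pi$; $\Sigma(\delta)=\{\gamma\in\mathcal{P}(\mathcal{S}):\boldsymbol{K}_1(\mu_{13},\gamma_{13})\le\delta_1,\ \boldsymbol{K}_2(\mu_{23},\gamma_{23})\le\delta_2\}$. *)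

theory Defs
  imports "HOL-Probability.Probability"
begin

definition proper_polish_metric :: "('a::topological_space \<Rightarrow> 'a \<Rightarrow> real) \<Rightarrow> bool" where
  "proper_polish_metric d \<longleftrightarrow>
     Metric_space UNIV d \<and>
     Metric_space.mtopology UNIV d = euclidean \<and>
     second_countable (Metric_space.mtopology UNIV d) \<and>
     Metric_space.mcomplete UNIV d \<and>
     (\<forall>x r. compactin (Metric_space.mtopology UNIV d) (Metric_space.mcball UNIV d x r))"

definition borel_probs :: "'a::topological_space measure set" where
  "borel_probs = space (prob_algebra borel)"

definition moment_probs ::
    "('a::topological_space \<Rightarrow> 'a \<Rightarrow> real) \<Rightarrow> real \<Rightarrow> 'a measure set" where
  "moment_probs d p =
     {\<mu> \<in> borel_probs. \<exists>x0. (\<integral>\<^sup>+ x. ennreal (d x0 x powr p) \<partial>\<mu>) < \<infinity>}"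

definition couplings ::
    "'a::topological_space measure \<Rightarrow> 'b::topological_space measure \<Rightarrow> ('a \<times> 'b) measure set" where
  "couplings \<mu> \<nu> = {\<pi> \<in> borel_probs. distr \<pi> borel fst = \<mu> \<and> distr \<pi> borel snd = \<nu>}"

definition transport_cost ::
    "('a::topological_space \<Rightarrow> 'a \<Rightarrow> real) \<Rightarrow> 'a measure \<Rightarrow> 'a measure \<Rightarrow> ennreal" where
  "transport_cost c \<mu> \<nu> = (INF \<pi>\<in>couplings \<mu> \<nu>. \<integral>\<^sup>+ z. ennreal (c (fst z) (snd z)) \<partial>\<pi>)"

definition power_cost :: "('a \<Rightarrow> 'a \<Rightarrow> real) \<Rightarrow> real \<Rightarrow> 'a \<Rightarrow> 'a \<Rightarrow> real" where
  "power_cost d p s s' = d s s' powr p"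

definition pr13 :: "'y1 \<times> 'y2 \<times> 'x \<Rightarrow> 'y1 \<times> 'x" where
  "pr13 = (\<lambda>(y1, y2, x). (y1, x))"

definition pr23 :: "'y1 \<times> 'y2 \<times> 'x \<Rightarrow> 'y2 \<times> 'x" where
  "pr23 = (\<lambda>(y1, y2, x). (y2, x))"

definition overlapping_class ::
    "('y1::topological_space \<times> 'x::topological_space) measure \<Rightarrow>
     ('y2::topological_space \<times> 'x) measure \<Rightarrow> ('y1 \<times> 'y2 \<times> 'x) measure set" where
  "overlapping_class \<mu>13 \<mu>23 =
     {\<gamma> \<in> borel_probs. distr \<gamma> borel pr13 = \<mu>13 \<and> distr \<gamma> borel pr23 = \<mu>23}"

definition uncertainty_set ::
    "('y1::topological_space \<times> 'x::topological_space \<Rightarrow> 'y1 \<times> 'x \<Rightarrow> real) \<Rightarrow>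
     ('y2::topological_space \<times> 'x \<Rightarrow> 'y2 \<times> 'x \<Rightarrow> real) \<Rightarrow>
     ('y1 \<times> 'x) measure \<Rightarrow> ('y2 \<times> 'x) measure \<Rightarrow> real ^ 2 \<Rightarrow> ('y1 \<times> 'y2 \<times> 'x) measure set" where
  "uncertainty_set c1 c2 \<mu>13 \<mu>23 \<delta> =
     {\<gamma> \<in> borel_probs.
        transport_cost c1 \<mu>13 (distr \<gamma> borel pr13) \<le> ennreal (\<delta> $ 1) \<and>
        transport_cost c2 \<mu>23 (distr \<gamma> borel pr23) \<le> ennreal (\<delta> $ 2)}"

definition upper_semicontinuous :: "('a::topological_space \<Rightarrow> real) \<Rightarrow> bool" where
  "upper_semicontinuous f \<longleftrightarrow> (\<forall>x a. f x < a \<longrightarrow> (\<forall>\<^sub>F y in nhds x. f y < a))"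

(* The Bochner integral would return 0 for a non-integrable f, so the integral is taken as
   the extended real "positive part minus negative part".  Note that infinity - infinity is
   infinity in ereal; a finite integral of the positive part rules this case out. *)
definition ext_integral :: "'a measure \<Rightarrow> ('a \<Rightarrow> real) \<Rightarrow> ereal" where
  "ext_integral M f =
     enn2ereal (\<integral>\<^sup>+ x. ennreal (f x) \<partial>M) - enn2ereal (\<integral>\<^sup>+ x. ennreal (- f x) \<partial>M)"

end

(* On a space that carries a nonnegative function H with compact sublevel sets, a sequence of laws
   with bounded H-moments has a subsequence realised by pointwise convergent random variables:
   a Borel code h into the real line whose inverse is sequentially continuous carries the laws to a
   tight sequence on the line, where Helly's selection theorem and Skorohod's theorem apply, and the
   continuous extension of the inverse to the closure of the range of h brings everything back.
   With convergence of random variables at hand, Fatou's lemma does the rest. Applied to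
   near-optimal couplings it gives lower semicontinuity of the transport cost; applied to
   C + e * H - f, which is nonnegative for suitable C by the subcritical growth of f, it gives
   upper semicontinuity of the integral of f along laws with bounded H-moments, as e tends to 0.
   Properness of the metrics is what makes the p-th powers of distances have compact sublevel sets. *)

theory Submission
  imports Defs
begin

subsection \<open>Coding by real numbers\<close>

text \<open>Mass may escape to infinity along a maximizing sequence: bounded
  \<open>H\<close>-moments keep the laws tight but do not make the moments converge. The strict
  inequalities \<open>p1' < p1\<close> and \<open>p2' < p2\<close> deal with this. Any small
  multiple \<open>e * H\<close> dominates \<open>f\<close> up to a constant, so the moment that may
  be lost costs at most \<open>e * B\<close>. The transport constraints suffer no such loss: the
  costs are nonnegative and continuous, and Fatou's inequality points in the direction wanted. The
  code into the line is not asked to be continuous. Pushing laws to the line takes measurability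
  only; continuity matters on the way back. A countable list of yes-no questions, membership in
  basic open sets, can therefore serve as a code.\<close>

definition ternary :: "(nat \<Rightarrow> bool) \<Rightarrow> real" where
  "ternary b = (\<Sum>i. of_bool (b i) * (1 / 3) ^ i)"

lemma summable_ternary: "summable (\<lambda>i. of_bool (b i) * (1 / 3 :: real) ^ i)"
  by (rule summable_comparison_test'[where g = "\<lambda>i. (1 / 3 :: real) ^ i" and N = 0]) auto

lemma ternary_nonneg: "0 \<le> ternary b"
  unfolding ternary_def by (rule suminf_nonneg[OF summable_ternary]) auto

lemma ternary_le: "ternary b \<le> 3 / 2"
proof -
  have "ternary b \<le> (\<Sum>i. (1 / 3 :: real) ^ i)"
    unfolding ternary_def by (rule suminf_le[OF _ summable_ternary]) auto
  also have "\<dots> = 3 / 2"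
    by (subst suminf_geometric) auto
  finally show ?thesis .
qed

lemma ternary_Suc: "ternary b = of_bool (b 0) + ternary (\<lambda>i. b (Suc i)) / 3"
proof -
  have "ternary b = (\<Sum>i. of_bool (b (Suc i)) * (1 / 3 :: real) ^ i * (1 / 3)) + of_bool (b 0)"
    using suminf_split_head[OF summable_ternary[of b]] unfolding ternary_def by (simp add: mult_ac)
  also have "(\<Sum>i. of_bool (b (Suc i)) * (1 / 3 :: real) ^ i * (1 / 3)) = ternary (\<lambda>i. b (Suc i)) * (1 / 3)"
    unfolding ternary_def by (rule suminf_mult2[OF summable_ternary, symmetric])
  finally show ?thesis by simp
qed

text \<open>Base 3 with digits 0 and 1 leaves gaps, as in the Cantor set: if the first difference is
  at digit \<open>j\<close>, the later digits make up for at most half of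
  \<open>(1 / 3) ^ j\<close>, so the codes are at least \<open>(1 / 3) ^ j / 2\<close> apart. Base 2
  would allow carries, and close codes could differ in every digit.\<close>

lemma ternary_close_imp_eq:
  assumes "\<bar>ternary b - ternary c\<bar> < (1 / 3) ^ i / 2"
  shows "b i = c i"
  using assms
proof (induction i arbitrary: b c)
  case 0
  show ?case
  proof (rule ccontr)
    assume "b 0 \<noteq> c 0"
    then show False
      using 0 ternary_Suc[of b] ternary_Suc[of c] ternary_nonneg[of "\<lambda>i. b (Suc i)"]
        ternary_nonneg[of "\<lambda>i. c (Suc i)"] ternary_le[of "\<lambda>i. b (Suc i)"] ternary_le[of "\<lambda>i. c (Suc i)"]
      by (cases "b 0"; cases "c 0") auto
  qed
next
  case (Suc i)
  have small: "(1 / 3) ^ i / 2 \<le> (1 / 2 :: real)" by (simp add: power_le_one)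
  have "b 0 = c 0"
  proof (rule ccontr)
    assume "b 0 \<noteq> c 0"
    then show False
      using Suc.prems small ternary_Suc[of b] ternary_Suc[of c] ternary_nonneg[of "\<lambda>i. b (Suc i)"]
        ternary_nonneg[of "\<lambda>i. c (Suc i)"] ternary_le[of "\<lambda>i. b (Suc i)"] ternary_le[of "\<lambda>i. c (Suc i)"]
      by (cases "b 0"; cases "c 0") auto
  qed
  then have "ternary b - ternary c = (ternary (\<lambda>i. b (Suc i)) - ternary (\<lambda>i. c (Suc i))) / 3"
    by (simp add: ternary_Suc[of b] ternary_Suc[of c] diff_divide_distrib)
  with Suc.prems have "\<bar>ternary (\<lambda>i. b (Suc i)) - ternary (\<lambda>i. c (Suc i))\<bar> < (1 / 3) ^ i / 2"
    by simp
  from Suc.IH[OF this] show ?case .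
qed

text \<open>The integer part of the code records the level of H and the ternary digits record membership
  in the sets of a countable basis. Along a sequence with convergent codes, the level is eventually
  constant, so the sequence enters a compact set, and membership in each basic set is eventually
  constant, so all limit points coincide.\<close>

lemma exists_real_coding:
  fixes H :: "'a::{metric_space, second_countable_topology} \<Rightarrow> real"
  assumes H[measurable]: "H \<in> borel_measurable borel"
    and compact: "\<And>r. compact {x. H x \<le> r}"
  obtains h :: "'a \<Rightarrow> real" where "h \<in> borel_measurable borel"
    and "\<And>r. bounded (h ` {x. H x \<le> r})"
    and "\<And>x. convergent (\<lambda>n. h (x n)) \<Longrightarrow> convergent x"
proof -
  obtain B :: "'a set set" where B: "countable B" "topological_basis B"
    using ex_countable_basis by blast
  have "B \<noteq> {}"
    using topological_basisE[OF B(2) open_UNIV UNIV_I] by blast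
  define U where "U = from_nat_into B"
  have range_U: "range U = B"
    unfolding U_def using B(1) \<open>B \<noteq> {}\<close> by simp
  then have open_U: "open (U i)" for i
    using B(2) topological_basis_open by blast
  then have [measurable]: "U i \<in> sets borel" for i by simp
  define N where "N x = nat \<lceil>H x\<rceil>" for x
  define c where "c x = ternary (\<lambda>i. x \<in> U i)" for x
  \<comment> \<open>The factor 3 leaves room for the fraction \<open>c x\<close>, which is at most
    3/2: codes from different levels are at least 3/2 apart, so a code difference below 1 fixes the
    level.\<close>
  define h where "h x = 3 * real (N x) + c x" for x
  have c_bounds: "0 \<le> c x" "c x \<le> 3 / 2" for x
    unfolding c_def by (rule ternary_nonneg ternary_le)+
  have H_le: "H x \<le> real (N x)" for x
    unfolding N_def by linarith
  have same_shell: "N x = N y" if "\<bar>h x - h y\<bar> < 1" for x y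
  proof -
    have "\<bar>real (N x) - real (N y)\<bar> < 1"
      using that c_bounds[of x] c_bounds[of y] unfolding h_def by linarith
    then show ?thesis by linarith
  qed
  show ?thesis
  proof
    show "h \<in> borel_measurable borel"
      unfolding h_def N_def c_def ternary_def by measurable
  next
    fix r
    have "norm (h x) \<le> 3 * (\<bar>r\<bar> + 1) + 3 / 2" if "H x \<le> r" for x
    proof -
      have "real (N x) \<le> \<bar>r\<bar> + 1" using that unfolding N_def by linarith
      then show ?thesis using c_bounds[of x] unfolding h_def by simp
    qed
    then show "bounded (h ` {x. H x \<le> r})"
      unfolding bounded_iff by blast
  next
    fix x :: "nat \<Rightarrow> 'a"
    assume "convergent (\<lambda>n. h (x n))"
    then have Cauchy: "Cauchy (\<lambda>n. h (x n))" by (rule convergent_Cauchy)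
    have close: "\<exists>m0. \<forall>m\<ge>m0. \<forall>n\<ge>m0. \<bar>h (x m) - h (x n)\<bar> < e" if "e > 0" for e
      using metric_CauchyD[OF Cauchy that] unfolding dist_real_def .
    obtain m0 where m0: "\<And>m n. m \<ge> m0 \<Longrightarrow> n \<ge> m0 \<Longrightarrow> \<bar>h (x m) - h (x n)\<bar> < 1"
      using close[of 1] by auto
    have N_const: "N (x m) = N (x m0)" if "m \<ge> m0" for m
      using m0[OF that order_refl] by (rule same_shell)
    define K where "K = {y. H y \<le> real (N (x m0))}"
    have "x (m + m0) \<in> K" for m
      using H_le[of "x (m + m0)"] N_const[of "m + m0"] unfolding K_def by simp
    moreover have "seq_compact K"
      using compact[of "real (N (x m0))"] unfolding K_def by (simp add: compact_eq_seq_compact_metric)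
    ultimately obtain y r where r: "strict_mono r" and lim: "(\<lambda>k. x (r k + m0)) \<longlonglongrightarrow> y"
      using seq_compactE[of K "\<lambda>m. x (m + m0)"] unfolding o_def by metis
    have "x \<longlonglongrightarrow> y"
    proof (rule topological_tendstoI)
      fix S assume "open S" "y \<in> S"
      then obtain V where "V \<in> B" "y \<in> V" "V \<subseteq> S"
        using topological_basisE[OF B(2)] by metis
      then obtain i where i: "y \<in> U i" "U i \<subseteq> S"
        using range_U by blast
      obtain m1 where m1: "\<And>m n. m \<ge> m1 \<Longrightarrow> n \<ge> m1 \<Longrightarrow> \<bar>h (x m) - h (x n)\<bar> < (1 / 3) ^ i / 2"
        using close[of "(1 / 3) ^ i / 2"] by auto
      have same_digit: "x m \<in> U i \<longleftrightarrow> x n \<in> U i" if "m \<ge> max m0 m1" "n \<ge> max m0 m1" for m n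
      proof -
        have "\<bar>c (x m) - c (x n)\<bar> < (1 / 3) ^ i / 2"
          using m1[of m n] N_const[of m] N_const[of n] that unfolding h_def by simp
        then show ?thesis
          unfolding c_def by (rule ternary_close_imp_eq)
      qed
      have "eventually (\<lambda>k. x (r k + m0) \<in> U i) sequentially"
        using lim open_U[of i] i(1) by (rule topological_tendstoD)
      then obtain k0 where k0: "\<And>k. k \<ge> k0 \<Longrightarrow> x (r k + m0) \<in> U i"
        unfolding eventually_sequentially by blast
      \<comment> \<open>One late term of the subsequence lies in \<open>U i\<close>; all terms past
        \<open>max m0 m1\<close> agree on membership in \<open>U i\<close>, so the whole tail
        follows it. This upgrades subsequential convergence to convergence.\<close>
      define k where "k = max k0 (m0 + m1)"
      have "r k + m0 \<ge> max m0 m1"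
        using seq_suble[OF r, of k] unfolding k_def by linarith
      then have "x m \<in> U i" if "m \<ge> max m0 m1" for m
        using same_digit[OF that \<open>r k + m0 \<ge> max m0 m1\<close>] k0[of k] by (simp add: k_def)
      then show "eventually (\<lambda>m. x m \<in> S) sequentially"
        unfolding eventually_sequentially using i(2) by blast
    qed
    then show "convergent x" unfolding convergent_def by blast
  qed
qed

text \<open>The decoder sends \<open>y\<close> to the limit of any sequence whose codes tend to
  \<open>y\<close>. The assumption also forces \<open>h\<close> to be injective: an interleaving of
  two constant sequences with equal codes must converge.\<close>

lemma continuous_decoding:
  fixes h :: "'a::metric_space \<Rightarrow> 'b::metric_space"
  assumes conv: "\<And>x. convergent (\<lambda>n. h (x n)) \<Longrightarrow> convergent x"
  obtains g where "continuous_on (closure (range h)) g" and "\<And>x. g (h x) = x"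
proof -
  have lim_eq: "lim x = lim z" "z \<longlonglongrightarrow> lim z" if x: "(\<lambda>n. h (x n)) \<longlonglongrightarrow> y" and z: "(\<lambda>n. h (z n)) \<longlonglongrightarrow> y" for x z y
  proof -
    \<comment> \<open>The interleaving of x and z has convergent images, hence converges itself.\<close>
    define w where "w n = (if even n then x (n div 2) else z (n div 2))" for n
    have half: "filterlim (\<lambda>n::nat. n div 2) sequentially sequentially"
      unfolding filterlim_at_top eventually_sequentially by (metis div_le_mono nonzero_mult_div_cancel_left zero_neq_numeral)
    have "(\<lambda>n. h (w n)) \<longlonglongrightarrow> y"
    proof (rule topological_tendstoI)
      fix S assume S: "open S" "y \<in> S"
      have "\<forall>\<^sub>F n in sequentially. h (x (n div 2)) \<in> S" "\<forall>\<^sub>F n in sequentially. h (z (n div 2)) \<in> S"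
        using filterlim_compose[OF x half] filterlim_compose[OF z half] S by (auto dest: topological_tendstoD)
      then show "\<forall>\<^sub>F n in sequentially. h (w n) \<in> S"
        by eventually_elim (simp add: w_def)
    qed
    then have "convergent (\<lambda>n. h (w n))"
      unfolding convergent_def by blast
    then obtain l where l: "w \<longlonglongrightarrow> l"
      using conv unfolding convergent_def by blast
    have "(\<lambda>n. w (2 * n)) \<longlonglongrightarrow> l" "(\<lambda>n. w (2 * n + 1)) \<longlonglongrightarrow> l"
      using LIMSEQ_subseq_LIMSEQ[OF l, of "\<lambda>n. 2 * n"] LIMSEQ_subseq_LIMSEQ[OF l, of "\<lambda>n. 2 * n + 1"]
      by (auto simp: strict_mono_def o_def)
    then have "x \<longlonglongrightarrow> l" "z \<longlonglongrightarrow> l"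
      unfolding w_def by auto
    then show "lim x = lim z" "z \<longlonglongrightarrow> lim z"
      by (auto simp: limI)
  qed
  \<comment> \<open>Only points of the closure of \<open>range h\<close> have such a sequence;
    elsewhere the choice is arbitrary and nothing is claimed about \<open>g\<close>.\<close>
  define s where "s y = (SOME x. (\<lambda>n. h (x n)) \<longlonglongrightarrow> y)" for y
  define g where "g y = lim (s y)" for y
  have g: "x \<longlonglongrightarrow> g y" if "(\<lambda>n. h (x n)) \<longlonglongrightarrow> y" for x y
  proof -
    have "(\<lambda>n. h (s y n)) \<longlonglongrightarrow> y"
      unfolding s_def by (rule someI[of "\<lambda>x. (\<lambda>n. h (x n)) \<longlonglongrightarrow> y", OF that])
    from lim_eq[OF this that] show ?thesis unfolding g_def by simp
  qed
  have g_h: "g (h x) = x" for x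
    using g[of "\<lambda>_. x" "h x"] by (simp add: LIMSEQ_const_iff)
  moreover have "continuous_on (closure (range h)) g"
    \<comment> \<open>Continuity on a closure need only be tested along sequences in
      \<open>range h\<close>, and these are sequences of codes.\<close>
    unfolding continuous_on_closure_sequentially
  proof (intro allI impI)
    fix a and y :: "nat \<Rightarrow> 'b"
    assume y: "a \<in> closure (range h) \<and> (\<forall>n. y n \<in> range h) \<and> y \<longlonglongrightarrow> a"
    then have "\<forall>n. \<exists>x. y n = h x" by blast
    then obtain x where x: "y = (\<lambda>n. h (x n))" by metis
    then have "x \<longlonglongrightarrow> g a" using y by (intro g) simp
    then show "(g \<circ> y) \<longlonglongrightarrow> g a" by (simp add: x o_def g_h)
  qed
  ultimately show ?thesis using that by blast
qed

subsection \<open>Convergent representations of laws\<close>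

lemma borel_probsD:
  assumes "\<mu> \<in> borel_probs"
  shows "prob_space \<mu>" and "sets \<mu> = sets borel" and "space \<mu> = UNIV"
  using assms sets_eq_imp_space_eq[of \<mu> borel] unfolding borel_probs_def space_prob_algebra by auto

lemma distr_in_borel_probs:
  assumes "prob_space \<Omega>" and "X \<in> borel_measurable \<Omega>"
  shows "distr \<Omega> borel X \<in> borel_probs"
  using assms unfolding borel_probs_def space_prob_algebra by (simp add: prob_space.prob_space_distr)

text \<open>A pointwise form of Prokhorov's theorem: compactness comes with random variables on one
  space, so every later passage to the limit is about convergent sequences of points. The limit law
  is the law of \<open>X\<close>.\<close>

lemma exists_convergent_representation:
  fixes H :: "'a::{metric_space, second_countable_topology} \<Rightarrow> real"
    and \<gamma> :: "nat \<Rightarrow> 'a measure"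
  assumes H[measurable]: "H \<in> borel_measurable borel"
    and nonneg: "\<And>x. 0 \<le> H x"
    and compact: "\<And>r. compact {x. H x \<le> r}"
    and prob: "\<And>n. \<gamma> n \<in> borel_probs"
    and bound: "\<And>n. (\<integral>\<^sup>+ x. ennreal (H x) \<partial>\<gamma> n) \<le> ennreal B"
  obtains r and \<Omega> :: "real measure" and Xs X where "strict_mono (r :: nat \<Rightarrow> nat)"
    and "prob_space \<Omega>"
    and "\<And>n. Xs n \<in> borel_measurable \<Omega>"
    and "\<And>n. distr \<Omega> borel (Xs n) = \<gamma> (r n)"
    and "X \<in> borel_measurable \<Omega>"
    and "\<And>\<omega>. \<omega> \<in> space \<Omega> \<Longrightarrow> (\<lambda>n. Xs n \<omega>) \<longlonglongrightarrow> X \<omega>"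
proof -
  have [measurable_cong]: "sets (\<gamma> n) = sets borel" for n
    using borel_probsD(2)[OF prob] .
  have space_\<gamma>: "space (\<gamma> n) = UNIV" for n
    using borel_probsD(3)[OF prob] .
  interpret \<gamma>: prob_space "\<gamma> n" for n
    using borel_probsD(1)[OF prob] .
  obtain h :: "'a \<Rightarrow> real" where h[measurable]: "h \<in> borel_measurable borel"
    and h_bounded: "\<And>r. bounded (h ` {x. H x \<le> r})"
    and h_conv: "\<And>x. convergent (\<lambda>n. h (x n)) \<Longrightarrow> convergent x"
    by (rule exists_real_coding[OF H compact]) blast
  obtain g where g_cont: "continuous_on (closure (range h)) g" and g_h: "\<And>x. g (h x) = x"
    by (rule continuous_decoding[of h]) (blast intro: h_conv)+
  define C where "C = closure (range h)"
  have [measurable]: "C \<in> sets borel" and "closed C"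
    unfolding C_def by auto
  have h_C: "h x \<in> C" for x
    unfolding C_def using closure_subset[of "range h"] by blast
  \<comment> \<open>\<open>g\<close> is continuous, hence measurable, only on \<open>C\<close>; a
    constant value off the closed set \<open>C\<close> makes a Borel function of it.\<close>
  define g' where "g' y = (if y \<in> C then g y else undefined)" for y
  have "g \<in> borel_measurable (restrict_space borel C)"
    using g_cont unfolding C_def by (rule borel_measurable_continuous_on_restrict)
  then have [measurable]: "g' \<in> borel_measurable borel"
    unfolding g'_def by (intro measurable_If_restrict_space_iff[THEN iffD2]) auto
  define \<mu> where "\<mu> n = distr (\<gamma> n) borel h" for n
  have rd: "real_distribution (\<mu> n)" for n
    unfolding \<mu>_def by (rule \<gamma>.real_distribution_distr) simp
  have "tight \<mu>"
    unfolding tight_def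
  proof (intro conjI allI impI rd)
    fix e :: real assume "e > 0"
    \<comment> \<open>Markov's inequality leaves mass at most \<open>\<bar>B\<bar> / R < e\<close>
      where \<open>R \<le> H x\<close>; the summand 1 keeps \<open>R\<close> positive when
      \<open>B\<close> is 0. The absolute value serves negative \<open>B\<close>, for which
      \<open>ennreal B\<close> is 0.\<close>
    define R where "R = (\<bar>B\<bar> + 1) / e"
    have "R > 0" unfolding R_def using \<open>e > 0\<close> by simp
    obtain b where b: "b > 0" "\<And>x. H x \<le> R \<Longrightarrow> \<bar>h x\<bar> < b"
      using h_bounded[of R] unfolding bounded_pos_less by auto
    have "measure (\<mu> n) {-b<..b} > 1 - e" for n
    proof -
      have int: "integrable (\<gamma> n) H"
        by (rule integrableI_nonneg) (use nonneg bound[of n] in \<open>auto simp: less_top[symmetric] top_unique\<close>)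
      have "ennreal (integral\<^sup>L (\<gamma> n) H) \<le> ennreal B"
        using bound[of n] nn_integral_eq_integral[OF int] nonneg by simp
      then have EH: "integral\<^sup>L (\<gamma> n) H \<le> \<bar>B\<bar>"
        by (metis abs_ge_self abs_ge_zero ennreal_le_iff2 order_trans)
      have "measure (\<gamma> n) {x\<in>space (\<gamma> n). R \<le> H x} \<le> integral\<^sup>L (\<gamma> n) H / R"
        by (rule integral_Markov_inequality_measure[where A = "{}"]) (use int nonneg \<open>R > 0\<close> in auto)
      also have "\<dots> \<le> \<bar>B\<bar> / R"
        using EH \<open>R > 0\<close> by (simp add: divide_right_mono)
      also have "\<dots> < e"
        unfolding R_def using \<open>e > 0\<close> by (simp add: field_simps)
      finally have small: "measure (\<gamma> n) {x\<in>space (\<gamma> n). R \<le> H x} < e" .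
      have "1 - measure (\<gamma> n) {x\<in>space (\<gamma> n). R \<le> H x} = measure (\<gamma> n) (space (\<gamma> n) - {x\<in>space (\<gamma> n). R \<le> H x})"
        by (rule \<gamma>.prob_compl[symmetric]) measurable
      also have "\<dots> \<le> measure (\<gamma> n) {x\<in>space (\<gamma> n). h x \<in> {-b<..b}}"
      proof (rule \<gamma>.finite_measure_mono)
        have "h x \<in> {-b<..b}" if "\<not> R \<le> H x" for x
          using b(2)[of x] that by auto
        then show "space (\<gamma> n) - {x\<in>space (\<gamma> n). R \<le> H x} \<subseteq> {x\<in>space (\<gamma> n). h x \<in> {-b<..b}}"
          by blast
      qed measurable
      also have "\<dots> = measure (\<mu> n) {-b<..b}"
        unfolding \<mu>_def by (subst measure_distr) (auto intro!: arg_cong[where f = "measure (\<gamma> n)"])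
      finally show ?thesis using small by linarith
    qed
    then show "\<exists>a b. a < b \<and> (\<forall>n. 1 - e < measure (\<mu> n) {a<..b})"
      using b(1) by (intro exI[of _ "-b"] exI[of _ b]) auto
  qed
  then obtain r M where r: "strict_mono r" and M: "real_distribution M" "weak_conv_m (\<mu> \<circ> id \<circ> r) M"
    using tight_imp_convergent_subsubsequence[of \<mu> id] by (auto simp: strict_mono_id)
  have "\<exists>(\<Omega> :: real measure) Ys Y. prob_space \<Omega> \<and> (\<forall>n. Ys n \<in> borel_measurable \<Omega>) \<and>
      (\<forall>n. distr \<Omega> borel (Ys n) = (\<mu> \<circ> id \<circ> r) n) \<and> Y \<in> measurable \<Omega> lborel \<and> distr \<Omega> borel Y = M \<and>
      (\<forall>\<omega>\<in>space \<Omega>. (\<lambda>n. Ys n \<omega>) \<longlonglongrightarrow> Y \<omega>)"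
    using M by (intro Skorohod) (auto intro: rd simp: o_def)
  then obtain \<Omega> :: "real measure" and Ys Y where \<Omega>: "prob_space \<Omega>"
    and Ys[measurable]: "\<And>n. Ys n \<in> borel_measurable \<Omega>" and distr_Ys: "\<And>n. distr \<Omega> borel (Ys n) = \<mu> (r n)"
    and Y: "Y \<in> measurable \<Omega> lborel" and lim: "\<And>\<omega>. \<omega> \<in> space \<Omega> \<Longrightarrow> (\<lambda>n. Ys n \<omega>) \<longlonglongrightarrow> Y \<omega>"
    unfolding o_apply id_apply by blast
  have [measurable]: "Y \<in> borel_measurable \<Omega>" using Y by simp
  define A where "A = {\<omega> \<in> space \<Omega>. \<forall>n. Ys n \<omega> \<in> C}"
  have [measurable]: "A \<in> sets \<Omega>" unfolding A_def by measurable
  have AE_A: "AE \<omega> in \<Omega>. \<omega> \<in> A"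
  proof -
    have "AE y in \<mu> (r n). y \<in> C" for n
      unfolding \<mu>_def by (subst AE_distr_iff) (auto simp: h_C)
    then have "AE \<omega> in \<Omega>. Ys n \<omega> \<in> C" for n
      by (subst (asm) distr_Ys[symmetric], subst (asm) AE_distr_iff) auto
    then have "AE \<omega> in \<Omega>. \<forall>n. Ys n \<omega> \<in> C" by (simp add: AE_all_countable)
    then show ?thesis unfolding A_def by (rule AE_mp) auto
  qed
  \<comment> \<open>Off the almost sure event \<open>A\<close> all variables take one common value.
    This leaves the laws unchanged and makes convergence hold at every point, so that no null sets
    have to be carried along.\<close>
  define Xs where "Xs n \<omega> = (if \<omega> \<in> A then g' (Ys n \<omega>) else undefined)" for n \<omega>
  define X where "X \<omega> = (if \<omega> \<in> A then g' (Y \<omega>) else undefined)" for \<omega>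
  have [measurable]: "Xs n \<in> borel_measurable \<Omega>" for n unfolding Xs_def by measurable
  have [measurable]: "X \<in> borel_measurable \<Omega>" unfolding X_def by measurable
  have "distr \<Omega> borel (Xs n) = \<gamma> (r n)" for n
  proof -
    have "distr \<Omega> borel (Xs n) = distr \<Omega> borel (\<lambda>\<omega>. g' (Ys n \<omega>))"
      by (rule distr_cong_AE) (use AE_A in \<open>auto simp: Xs_def\<close>)
    also have "\<dots> = distr (\<mu> (r n)) borel g'"
      unfolding distr_Ys[symmetric] by (subst distr_distr) (auto simp: o_def)
    also have "\<dots> = distr (\<gamma> (r n)) borel (\<lambda>x. x)"
      unfolding \<mu>_def by (subst distr_distr) (auto simp: o_def g'_def h_C g_h)
    also have "\<dots> = \<gamma> (r n)"
      by (rule distr_id2) (rule borel_probsD(2)[OF prob, symmetric])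
    finally show ?thesis .
  qed
  moreover have "(\<lambda>n. Xs n \<omega>) \<longlonglongrightarrow> X \<omega>" if "\<omega> \<in> space \<Omega>" for \<omega>
  proof (cases "\<omega> \<in> A")
    case True
    then have in_C: "Ys n \<omega> \<in> C" for n unfolding A_def by simp
    \<comment> \<open>A limit of codes need not be a code itself, which is why the decoding was
      extended to the closure.\<close>
    then have "Y \<omega> \<in> C"
      using closed_sequentially[OF \<open>closed C\<close> _ lim[OF that]] by blast
    then have "(\<lambda>n. g (Ys n \<omega>)) \<longlonglongrightarrow> g (Y \<omega>)"
      using continuous_on_tendsto_compose[OF g_cont[folded C_def] lim[OF that]] in_C by simp
    with True in_C \<open>Y \<omega> \<in> C\<close> show ?thesis unfolding Xs_def X_def g'_def by simp
  qed (simp add: Xs_def X_def)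
  ultimately show ?thesis
    using that[OF r \<Omega>, of Xs X] by simp
qed

text \<open>By dominated convergence the two limits give every bounded continuous function the same
  integral, and such functions approximate indicators of closed sets. The spaces \<open>P\<close>
  and \<open>Q\<close> may differ, since each representation comes with a space of its own.\<close>

lemma distr_limit_unique:
  fixes X :: "'a \<Rightarrow> 'c::metric_space" and Z :: "'b \<Rightarrow> 'c"
  assumes P: "prob_space P" and Q: "prob_space Q"
    and Xs[measurable]: "\<And>n. Xs n \<in> borel_measurable P" and X[measurable]: "X \<in> borel_measurable P"
    and Zs[measurable]: "\<And>n. Zs n \<in> borel_measurable Q" and Z[measurable]: "Z \<in> borel_measurable Q"
    and eq: "\<And>n::nat. distr P borel (Xs n) = distr Q borel (Zs n)"
    and X_lim: "\<And>\<omega>. \<omega> \<in> space P \<Longrightarrow> (\<lambda>n. Xs n \<omega>) \<longlonglongrightarrow> X \<omega>"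
    and Z_lim: "\<And>\<omega>. \<omega> \<in> space Q \<Longrightarrow> (\<lambda>n. Zs n \<omega>) \<longlonglongrightarrow> Z \<omega>"
  shows "distr P borel X = distr Q borel Z"
proof -
  interpret P: prob_space P by fact
  interpret Q: prob_space Q by fact
  have int_eq: "(\<integral>\<omega>. \<phi> (X \<omega>) \<partial>P) = (\<integral>\<omega>. \<phi> (Z \<omega>) \<partial>Q)"
    if cont: "continuous_on UNIV \<phi>" and bound: "\<And>x. \<bar>\<phi> x\<bar> \<le> 1" for \<phi> :: "'c \<Rightarrow> real"
  proof -
    have [measurable]: "\<phi> \<in> borel_measurable borel"
      using cont by (rule borel_measurable_continuous_onI)
    have \<phi>_lim: "(\<lambda>n. \<phi> (y n)) \<longlonglongrightarrow> \<phi> l" if "y \<longlonglongrightarrow> l" for y l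
      using continuous_on_tendsto_compose[OF cont that] by simp
    have "(\<lambda>n. \<integral>\<omega>. \<phi> (Xs n \<omega>) \<partial>P) \<longlonglongrightarrow> (\<integral>\<omega>. \<phi> (X \<omega>) \<partial>P)"
      by (rule integral_dominated_convergence[where w = "\<lambda>_. 1"])
        (use bound X_lim in \<open>auto intro!: AE_I2 \<phi>_lim\<close>)
    moreover have "(\<lambda>n. \<integral>\<omega>. \<phi> (Zs n \<omega>) \<partial>Q) \<longlonglongrightarrow> (\<integral>\<omega>. \<phi> (Z \<omega>) \<partial>Q)"
      by (rule integral_dominated_convergence[where w = "\<lambda>_. 1"])
        (use bound Z_lim in \<open>auto intro!: AE_I2 \<phi>_lim\<close>)
    moreover have "(\<integral>\<omega>. \<phi> (Xs n \<omega>) \<partial>P) = (\<integral>\<omega>. \<phi> (Zs n \<omega>) \<partial>Q)" for n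
      using arg_cong[OF eq[of n], of "\<lambda>M. integral\<^sup>L M \<phi>"] by (simp add: integral_distr)
    ultimately show ?thesis
      using LIMSEQ_unique by fastforce
  qed
  have closed_eq: "emeasure (distr P borel X) F = emeasure (distr Q borel Z) F" if "closed F" for F
  \<comment> \<open>The empty set is set apart because \<open>infdist\<close> to it is 0 by
    convention, so the functions \<open>\<phi> k\<close> would be constantly 1.\<close>
  proof (cases "F = {}")
    case False
    have [measurable]: "F \<in> sets borel" using \<open>closed F\<close> by simp
    define \<phi> :: "nat \<Rightarrow> 'c \<Rightarrow> real" where "\<phi> k x = max 0 (1 - real k * infdist x F)" for k x
    have cont: "continuous_on UNIV (\<phi> k)" for k
      unfolding \<phi>_def by (intro continuous_intros)
    then have [measurable]: "\<phi> k \<in> borel_measurable borel" for k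
      by (rule borel_measurable_continuous_onI)
    have bound: "\<bar>\<phi> k x\<bar> \<le> 1" for k x
      unfolding \<phi>_def using infdist_nonneg[of x F] by (simp add: max_def)
    have lim: "(\<lambda>k. \<phi> k x) \<longlonglongrightarrow> indicator F x" for x
    proof (cases "x \<in> F")
      case True
      then show ?thesis by (simp add: \<phi>_def)
    next
      case outside: False
      then have pos: "infdist x F > 0"
        using infdist_pos_not_in_closed[OF \<open>closed F\<close> False] by simp
      obtain k0 :: nat where "1 / infdist x F < real k0" using reals_Archimedean2 by blast
      then have "\<phi> k x = 0" if "k \<ge> k0" for k
      proof -
        have "1 / infdist x F < real k" using \<open>1 / infdist x F < real k0\<close> that by linarith
        then show ?thesis unfolding \<phi>_def using pos by (simp add: field_simps)
      qed
      then have "eventually (\<lambda>k. \<phi> k x = 0) sequentially"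
        unfolding eventually_sequentially by blast
      then show ?thesis
        using outside by (simp add: tendsto_eventually)
    qed
    have "(\<lambda>k. \<integral>\<omega>. \<phi> k (X \<omega>) \<partial>P) \<longlonglongrightarrow> (\<integral>\<omega>. indicator F (X \<omega>) \<partial>P)"
      by (rule integral_dominated_convergence[where w = "\<lambda>_. 1"]) (use bound lim in auto)
    moreover have "(\<lambda>k. \<integral>\<omega>. \<phi> k (Z \<omega>) \<partial>Q) \<longlonglongrightarrow> (\<integral>\<omega>. indicator F (Z \<omega>) \<partial>Q)"
      by (rule integral_dominated_convergence[where w = "\<lambda>_. 1"]) (use bound lim in auto)
    ultimately have "(\<integral>\<omega>. indicator F (X \<omega>) \<partial>P) = (\<integral>\<omega>. indicator F (Z \<omega>) \<partial>Q :: real)"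
      using LIMSEQ_unique int_eq[OF cont bound] by fastforce
    moreover have "(\<integral>\<omega>. indicator F (X \<omega>) \<partial>P) = measure (distr P borel X) F"
      using integral_distr[OF X, of "indicator F :: 'c \<Rightarrow> real"] by simp
    moreover have "(\<integral>\<omega>. indicator F (Z \<omega>) \<partial>Q) = measure (distr Q borel Z) F"
      using integral_distr[OF Z, of "indicator F :: 'c \<Rightarrow> real"] by simp
    ultimately show ?thesis
      using P.prob_space_distr[OF X] Q.prob_space_distr[OF Z]
      by (simp add: prob_space_def finite_measure.emeasure_eq_measure)
  qed simp
  show ?thesis
  proof (rule measure_eqI_generator_eq[where E = "Collect closed" and \<Omega> = UNIV and A = "\<lambda>_. UNIV"])
    show "Int_stable (Collect closed :: 'c set set)"
      by (auto simp: Int_stable_def)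
    show "emeasure (distr P borel X) UNIV \<noteq> \<infinity>"
      by (simp add: emeasure_distr)
  qed (use closed_eq in \<open>auto simp: borel_eq_closed\<close>)
qed

subsection \<open>Lower semicontinuity of the transport cost\<close>

text \<open>Fatou's lemma with bounds that converge; it serves the moments, the transport costs and
  the objective alike.\<close>

lemma nn_integral_le_of_liminf:
  fixes u :: "nat \<Rightarrow> 'a \<Rightarrow> ennreal"
  assumes "\<And>n. u n \<in> borel_measurable M"
    and "\<And>x. x \<in> space M \<Longrightarrow> v x \<le> liminf (\<lambda>n. u n x)"
    and "\<And>n. integral\<^sup>N M (u n) \<le> b n" and "b \<longlonglongrightarrow> L"
  shows "integral\<^sup>N M v \<le> L"
proof -
  have "integral\<^sup>N M v \<le> (\<integral>\<^sup>+ x. liminf (\<lambda>n. u n x) \<partial>M)"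
    by (rule nn_integral_mono) (rule assms(2))
  also have "\<dots> \<le> liminf (\<lambda>n. integral\<^sup>N M (u n))"
    by (rule nn_integral_liminf) (rule assms(1))
  also have "\<dots> \<le> liminf b"
    using assms(3) by (intro Liminf_mono) auto
  also have "\<dots> = L"
    using assms(4) by (intro lim_imp_Liminf) auto
  finally show ?thesis .
qed

lemma compact_closed_subset:
  fixes K :: "'a::topological_space set"
  assumes "compact K" "S \<subseteq> K" "closed S"
  shows "compact S"
  using compact_Int_closed[OF assms(1,3)] assms(2) by (simp add: inf.absorb2)

lemma powr_add_le:
  fixes a b p :: real
  assumes "0 \<le> a" "0 \<le> b" "0 \<le> p"
  shows "(a + b) powr p \<le> 2 powr p * (a powr p + b powr p)"
proof -
  have "(a + b) powr p \<le> (2 * max a b) powr p"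
    using assms by (intro powr_mono2) auto
  also have "\<dots> = 2 powr p * max a b powr p"
    by (rule powr_mult)
  also have "\<dots> \<le> 2 powr p * (a powr p + b powr p)"
    by (intro mult_left_mono) (auto simp: max_def)
  finally show ?thesis .
qed

text \<open>\<open>d\<close> shares nothing but its topology with the class metric of the types it
  is used at, so continuity and compactness are brought over through the equation between
  \<open>mtopology\<close> and \<open>euclidean\<close>.\<close>

lemma proper_polish_metricD:
  fixes d :: "'a::topological_space \<Rightarrow> 'a \<Rightarrow> real"
  assumes "proper_polish_metric d"
  shows "0 \<le> d x y" "d x x = 0" "d x z \<le> d x y + d y z"
    and "compact {y. d x y \<le> r}"
    and "continuous_on UNIV (\<lambda>z. d (fst z) (snd z))"
proof -
  have topo: "Metric_space.mtopology UNIV d = euclidean"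
    using assms unfolding proper_polish_metric_def by blast
  interpret Metric_space UNIV d
    using assms unfolding proper_polish_metric_def by blast
  show "0 \<le> d x y" "d x x = 0" "d x z \<le> d x y + d y z"
    using triangle by simp_all
  have "compactin mtopology (mcball x r)"
    using assms unfolding proper_polish_metric_def by blast
  then show "compact {y. d x y \<le> r}"
    unfolding topo mcball_def by simp
  have "((\<lambda>z. d (fst z) (snd z)) \<longlongrightarrow> d (fst w) (snd w)) (at w)" for w
  proof -
    have "((\<lambda>z. d (fst z) (fst w)) \<longlongrightarrow> 0) (at w)"
      using limitin_metric_dist_null[of fst "fst w" "at w"] tendsto_fst[OF tendsto_ident_at[of w UNIV]]
      unfolding topo by simp
    moreover have "((\<lambda>z. d (snd z) (snd w)) \<longlongrightarrow> 0) (at w)"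
      using limitin_metric_dist_null[of snd "snd w" "at w"] tendsto_snd[OF tendsto_ident_at[of w UNIV]]
      unfolding topo by simp
    ultimately have lim: "((\<lambda>z. d (fst z) (fst w) + d (snd z) (snd w)) \<longlongrightarrow> 0) (at w)"
      using tendsto_add_zero by blast
    have "\<bar>d (fst z) (snd z) - d (fst w) (snd w)\<bar> \<le> d (fst z) (fst w) + d (snd z) (snd w)" for z
      using triangle[of "fst z" "fst w" "snd z"] triangle[of "fst w" "snd w" "snd z"]
        triangle[of "fst w" "fst z" "snd w"] triangle[of "fst z" "snd z" "snd w"]
        commute[of "fst z" "fst w"] commute[of "snd z" "snd w"] by auto
    then have "((\<lambda>z. d (fst z) (snd z) - d (fst w) (snd w)) \<longlongrightarrow> 0) (at w)"
      by (intro Lim_null_comparison[OF _ lim]) auto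
    then show ?thesis by (rule LIM_zero_cancel)
  qed
  then show "continuous_on UNIV (\<lambda>z. d (fst z) (snd z))"
    by (simp add: continuous_on_def)
qed

lemma continuous_on_metric_powr:
  assumes d: "proper_polish_metric d" and "0 < p"
    and "continuous_on S f" "continuous_on S g"
  shows "continuous_on S (\<lambda>x. d (f x) (g x) powr p)"
proof -
  have "continuous_on S (\<lambda>x. d (fst (f x, g x)) (snd (f x, g x)))"
    by (rule continuous_on_compose2[OF proper_polish_metricD(5)[OF d]])
      (use assms in \<open>auto intro: continuous_on_Pair\<close>)
  then show ?thesis
    using \<open>0 < p\<close> proper_polish_metricD(1)[OF d]
    by (intro continuous_on_powr' continuous_on_const) auto
qed

lemma compact_metric_powr_le:
  assumes d: "proper_polish_metric d" and "0 < p"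
  shows "compact {y. d x y powr p \<le> r}"
proof -
  \<comment> \<open>\<open>\<bar>r\<bar>\<close> covers negative \<open>r\<close>, where the set on
    the left is empty.\<close>
  have "{y. d x y powr p \<le> r} \<subseteq> {y. d x y \<le> \<bar>r\<bar> powr (1 / p)}"
  proof safe
    fix y assume "d x y powr p \<le> r"
    then have "(d x y powr p) powr (1 / p) \<le> \<bar>r\<bar> powr (1 / p)"
      using \<open>0 < p\<close> by (intro powr_mono2) auto
    then show "d x y \<le> \<bar>r\<bar> powr (1 / p)"
      using \<open>0 < p\<close> proper_polish_metricD(1)[OF d] by (simp add: powr_powr)
  qed
  moreover have "closed {y. d x y powr p \<le> r}"
    by (intro closed_Collect_le continuous_on_metric_powr[OF assms] continuous_intros)
  ultimately show ?thesis
    by (rule compact_closed_subset[OF proper_polish_metricD(4)[OF d]])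
qed

lemma couplingsD:
  assumes "\<pi> \<in> couplings \<mu> \<nu>"
  shows "\<pi> \<in> borel_probs" "distr \<pi> borel fst = \<mu>" "distr \<pi> borel snd = \<nu>"
  using assms unfolding couplings_def by auto

lemma measurable_metric_powr:
  fixes d :: "'a::{metric_space, second_countable_topology} \<Rightarrow> 'a \<Rightarrow> real"
  assumes "proper_polish_metric d" "0 < p"
  shows "(\<lambda>z. ennreal (d (fst z) (snd z) powr p)) \<in> borel_measurable borel"
    and "(\<lambda>y. ennreal (d x y powr p)) \<in> borel_measurable borel"
proof -
  have "(\<lambda>z. d (fst z) (snd z) powr p) \<in> borel_measurable borel"
    by (intro borel_measurable_continuous_onI continuous_on_metric_powr[OF assms] continuous_intros)
  then show "(\<lambda>z. ennreal (d (fst z) (snd z) powr p)) \<in> borel_measurable borel"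
    by measurable
  have "(\<lambda>y. d x y powr p) \<in> borel_measurable borel"
    by (intro borel_measurable_continuous_onI continuous_on_metric_powr[OF assms] continuous_intros)
  then show "(\<lambda>y. ennreal (d x y powr p)) \<in> borel_measurable borel"
    by measurable
qed

lemma measurable_fst_snd_borel:
  "fst \<in> borel \<rightarrow>\<^sub>M (borel :: 'a::topological_space measure)"
  "snd \<in> borel \<rightarrow>\<^sub>M (borel :: 'b::topological_space measure)"
  by (intro borel_measurable_continuous_onI continuous_intros)+

lemma couplings_measurable:
  assumes \<pi>: "\<pi> \<in> couplings \<mu> \<nu>" and f: "f \<in> borel \<rightarrow>\<^sub>M N"
  shows "f \<in> \<pi> \<rightarrow>\<^sub>M N"
  using f measurable_cong_sets[OF borel_probsD(2)[OF couplingsD(1)[OF \<pi>]] refl] by blast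

lemma nn_integral_coupling:
  fixes f :: "_ \<Rightarrow> ennreal"
  assumes \<pi>: "\<pi> \<in> couplings \<mu> \<nu>" and f: "f \<in> borel_measurable borel"
  shows "(\<integral>\<^sup>+ z. f (fst z) \<partial>\<pi>) = integral\<^sup>N \<mu> f" and "(\<integral>\<^sup>+ z. f (snd z) \<partial>\<pi>) = integral\<^sup>N \<nu> f"
  unfolding couplingsD(2,3)[OF \<pi>, symmetric]
  by (auto intro!: nn_integral_distr[symmetric] f couplings_measurable[OF \<pi>] measurable_fst_snd_borel)

text \<open>Under the coupling, \<open>d x0 (snd z)\<close> is at most
  \<open>d x0 (fst z) + d (fst z) (snd z)\<close>: a law at finite cost from \<open>\<mu>\<close>
  inherits its moment. The uniform moment bounds, and with them tightness, rest on this.\<close>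

lemma coupling_moment_le:
  fixes d :: "'a::{metric_space, second_countable_topology} \<Rightarrow> 'a \<Rightarrow> real"
  assumes d: "proper_polish_metric d" and p: "0 < p" and \<pi>: "\<pi> \<in> couplings \<mu> \<nu>"
  shows "(\<integral>\<^sup>+ y. ennreal (d x0 y powr p) \<partial>\<nu>) \<le> ennreal (2 powr p) *
    ((\<integral>\<^sup>+ x. ennreal (d x0 x powr p) \<partial>\<mu>) + (\<integral>\<^sup>+ z. ennreal (power_cost d p (fst z) (snd z)) \<partial>\<pi>))"
proof -
  note meas = measurable_metric_powr[OF d p]
  have m1: "(\<lambda>z. ennreal (d x0 (fst z) powr p)) \<in> borel_measurable \<pi>"
    by (rule couplings_measurable[OF \<pi>], rule measurable_compose[OF measurable_fst_snd_borel(1) meas(2)])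
  have m2: "(\<lambda>z. ennreal (d (fst z) (snd z) powr p)) \<in> borel_measurable \<pi>"
    by (rule couplings_measurable[OF \<pi> meas(1)])
  have "(\<integral>\<^sup>+ y. ennreal (d x0 y powr p) \<partial>\<nu>) = (\<integral>\<^sup>+ z. ennreal (d x0 (snd z) powr p) \<partial>\<pi>)"
    by (rule nn_integral_coupling(2)[OF \<pi> meas(2), symmetric])
  also have "\<dots> \<le> (\<integral>\<^sup>+ z. ennreal (2 powr p) * (ennreal (d x0 (fst z) powr p) + ennreal (d (fst z) (snd z) powr p)) \<partial>\<pi>)"
  proof (rule nn_integral_mono)
    fix z
    have "d x0 (snd z) powr p \<le> (d x0 (fst z) + d (fst z) (snd z)) powr p"
      using p by (intro powr_mono2 proper_polish_metricD[OF d]) auto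
    also have "\<dots> \<le> 2 powr p * (d x0 (fst z) powr p + d (fst z) (snd z) powr p)"
      using p by (intro powr_add_le proper_polish_metricD[OF d]) auto
    finally show "ennreal (d x0 (snd z) powr p) \<le>
        ennreal (2 powr p) * (ennreal (d x0 (fst z) powr p) + ennreal (d (fst z) (snd z) powr p))"
      by (simp flip: ennreal_plus ennreal_mult'' add: ennreal_leI)
  qed
  also have "\<dots> = ennreal (2 powr p) *
      ((\<integral>\<^sup>+ z. ennreal (d x0 (fst z) powr p) \<partial>\<pi>) + (\<integral>\<^sup>+ z. ennreal (d (fst z) (snd z) powr p) \<partial>\<pi>))"
    using m1 m2 by (simp add: nn_integral_cmult nn_integral_add)
  also have "(\<integral>\<^sup>+ z. ennreal (d x0 (fst z) powr p) \<partial>\<pi>) = (\<integral>\<^sup>+ x. ennreal (d x0 x powr p) \<partial>\<mu>)"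
    by (rule nn_integral_coupling(1)[OF \<pi> meas(2)])
  finally show ?thesis unfolding power_cost_def .
qed

text \<open>An infimum comes with near-minimizers only; the slack \<open>e\<close> is later sent to
  0 or absorbed into a moment bound.\<close>

lemma exists_coupling_cost_le:
  assumes "transport_cost c \<mu> \<nu> \<le> ennreal a" and "0 \<le> a" and "0 < e"
  obtains \<pi> where "\<pi> \<in> couplings \<mu> \<nu>"
    and "(\<integral>\<^sup>+ z. ennreal (c (fst z) (snd z)) \<partial>\<pi>) \<le> ennreal (a + e)"
proof -
  have "transport_cost c \<mu> \<nu> < ennreal (a + e)"
    using assms by (intro le_less_trans[OF assms(1)]) (simp add: ennreal_less_iff)
  then show ?thesis
    using that unfolding transport_cost_def INF_less_iff by (auto intro: less_imp_le)
qed

text \<open>Representing the couplings by convergent pairs turns a limit of couplings into the law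
  of the limit pair. What remains is to recognise its marginals, the second of which is given
  through \<open>X\<close> on the unrelated space \<open>P\<close>.\<close>

lemma transport_cost_limit_le:
  fixes d :: "'a::{metric_space, second_countable_topology} \<Rightarrow> 'a \<Rightarrow> real"
  assumes d: "proper_polish_metric d" and p: "1 \<le> p" and \<mu>: "\<mu> \<in> moment_probs d p"
    and P: "prob_space P"
    and Xs[measurable]: "\<And>n. Xs n \<in> borel_measurable P" and X[measurable]: "X \<in> borel_measurable P"
    and lim: "\<And>\<omega>. \<omega> \<in> space P \<Longrightarrow> (\<lambda>n. Xs n \<omega>) \<longlonglongrightarrow> X \<omega>"
    and a: "0 \<le> a"
    and cost: "\<And>n. transport_cost (power_cost d p) \<mu> (distr P borel (Xs n)) \<le> ennreal a"
  shows "transport_cost (power_cost d p) \<mu> (distr P borel X) \<le> ennreal a"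
proof -
  have "0 < p" using p by simp
  note cost_cont = continuous_on_metric_powr[OF d \<open>0 < p\<close>]
  note meas = measurable_metric_powr[OF d \<open>0 < p\<close>]
  let ?c = "\<lambda>z. ennreal (power_cost d p (fst z) (snd z))"
  \<comment> \<open>The slack \<open>1 / Suc n\<close> vanishes in the limit and never exceeds 1, so
    all costs are at most \<open>a + 1\<close>.\<close>
  have "\<exists>\<pi>. \<pi> \<in> couplings \<mu> (distr P borel (Xs n)) \<and> integral\<^sup>N \<pi> ?c \<le> ennreal (a + 1 / Suc n)" for n
    using exists_coupling_cost_le[OF cost a, of "1 / Suc n" n] by auto
  then obtain \<pi> where \<pi>: "\<And>n. \<pi> n \<in> couplings \<mu> (distr P borel (Xs n))"
    and \<pi>_cost: "\<And>n. integral\<^sup>N (\<pi> n) ?c \<le> ennreal (a + 1 / Suc n)"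
    by metis
  obtain x0 where "(\<integral>\<^sup>+ x. ennreal (d x0 x powr p) \<partial>\<mu>) < \<infinity>"
    using \<mu> unfolding moment_probs_def by auto
  then obtain K where K: "(\<integral>\<^sup>+ x. ennreal (d x0 x powr p) \<partial>\<mu>) = ennreal K" "0 \<le> K"
    by (cases "\<integral>\<^sup>+ x. ennreal (d x0 x powr p) \<partial>\<mu>") auto
  \<comment> \<open>Moments of both coordinates enter; a bound on one alone would leave the other
    coordinate unconstrained.\<close>
  define H where "H z = d x0 (fst z) powr p + d x0 (snd z) powr p" for z
  have H_cont: "continuous_on UNIV H"
    unfolding H_def by (intro continuous_intros cost_cont)
  have H_nonneg: "0 \<le> H z" for z unfolding H_def by simp
  have H_compact: "compact {z. H z \<le> r}" for r
  proof -
    have "compact ({y. d x0 y powr p \<le> r} \<times> {y. d x0 y powr p \<le> r})"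
      by (intro compact_Times compact_metric_powr_le[OF d \<open>0 < p\<close>])
    moreover have "{z. H z \<le> r} \<subseteq> {y. d x0 y powr p \<le> r} \<times> {y. d x0 y powr p \<le> r}"
      by (auto simp: H_def intro: order_trans[rotated])
    moreover have "closed {z. H z \<le> r}"
      by (intro closed_Collect_le H_cont continuous_on_const)
    ultimately show ?thesis by (rule compact_closed_subset)
  qed
  \<comment> \<open>\<open>K\<close> is the moment of the first marginal \<open>\<mu>\<close>; the
    second summand is the bound of \<open>coupling_moment_le\<close> at cost
    \<open>a + 1\<close>.\<close>
  have H_bound: "(\<integral>\<^sup>+ z. ennreal (H z) \<partial>\<pi> n) \<le> ennreal (K + 2 powr p * (K + (a + 1)))" for n
  proof -
    have "(\<integral>\<^sup>+ z. ennreal (H z) \<partial>\<pi> n) =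
        (\<integral>\<^sup>+ z. ennreal (d x0 (fst z) powr p) \<partial>\<pi> n) + (\<integral>\<^sup>+ z. ennreal (d x0 (snd z) powr p) \<partial>\<pi> n)"
      unfolding H_def ennreal_plus[OF powr_ge_zero powr_ge_zero]
      by (intro nn_integral_add couplings_measurable[OF \<pi>]
          measurable_compose[OF measurable_fst_snd_borel(1) meas(2)]
          measurable_compose[OF measurable_fst_snd_borel(2) meas(2)])
    also have "(\<integral>\<^sup>+ z. ennreal (d x0 (fst z) powr p) \<partial>\<pi> n) = ennreal K"
      unfolding K(1)[symmetric] by (rule nn_integral_coupling(1)[OF \<pi> meas(2)])
    also have "(\<integral>\<^sup>+ z. ennreal (d x0 (snd z) powr p) \<partial>\<pi> n) = (\<integral>\<^sup>+ y. ennreal (d x0 y powr p) \<partial>distr P borel (Xs n))"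
      by (rule nn_integral_coupling(2)[OF \<pi> meas(2)])
    also have "\<dots> \<le> ennreal (2 powr p) * (ennreal K + ennreal (a + 1))"
    proof (rule order_trans[OF coupling_moment_le[OF d \<open>0 < p\<close> \<pi>[of n]]])
      have "integral\<^sup>N (\<pi> n) ?c \<le> ennreal (a + 1)"
        using \<pi>_cost[of n] by (rule order_trans) (intro ennreal_leI, simp)
      then show "ennreal (2 powr p) * ((\<integral>\<^sup>+ x. ennreal (d x0 x powr p) \<partial>\<mu>) + integral\<^sup>N (\<pi> n) ?c)
          \<le> ennreal (2 powr p) * (ennreal K + ennreal (a + 1))"
        unfolding K(1) by (intro mult_left_mono add_left_mono) auto
    qed
    finally show ?thesis
      using K(2) a by (simp add: ennreal_mult ennreal_plus add_left_mono)
  qed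
  obtain r and \<Omega> :: "real measure" and Zs Z where r: "strict_mono (r :: nat \<Rightarrow> nat)"
    and \<Omega>: "prob_space \<Omega>"
    and Zs[measurable]: "\<And>n. Zs n \<in> borel_measurable \<Omega>"
    and distr_Zs: "\<And>n. distr \<Omega> borel (Zs n) = \<pi> (r n)"
    and Z[measurable]: "Z \<in> borel_measurable \<Omega>"
    and Z_lim: "\<And>\<omega>. \<omega> \<in> space \<Omega> \<Longrightarrow> (\<lambda>n. Zs n \<omega>) \<longlonglongrightarrow> Z \<omega>"
    by (rule exists_convergent_representation[where \<gamma> = \<pi>, OF borel_measurable_continuous_onI[OF H_cont]
        H_nonneg H_compact couplingsD(1)[OF \<pi>] H_bound]) blast
  note measurable_fst_snd_borel[measurable]
  have marginals: "distr \<Omega> borel (\<lambda>\<omega>. fst (Zs n \<omega>)) = \<mu>"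
    "distr \<Omega> borel (\<lambda>\<omega>. snd (Zs n \<omega>)) = distr P borel (Xs (r n))" for n
  proof -
    have "distr \<Omega> borel (\<lambda>\<omega>. fst (Zs n \<omega>)) = distr (distr \<Omega> borel (Zs n)) borel fst"
      "distr \<Omega> borel (\<lambda>\<omega>. snd (Zs n \<omega>)) = distr (distr \<Omega> borel (Zs n)) borel snd"
      by (auto simp: distr_distr o_def)
    then show "distr \<Omega> borel (\<lambda>\<omega>. fst (Zs n \<omega>)) = \<mu>"
      "distr \<Omega> borel (\<lambda>\<omega>. snd (Zs n \<omega>)) = distr P borel (Xs (r n))"
      using couplingsD(2,3)[OF \<pi>[of "r n"]] distr_Zs by simp_all
  qed
  \<comment> \<open>The first marginals are all \<open>\<mu>\<close>, so a constant sequence serves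
    for comparison.\<close>
  have "distr \<Omega> borel (\<lambda>\<omega>. fst (Z \<omega>)) = distr \<Omega> borel (\<lambda>\<omega>. fst (Zs 0 \<omega>))"
    by (rule distr_limit_unique[OF \<Omega> \<Omega>, where Xs = "\<lambda>n \<omega>. fst (Zs n \<omega>)" and Zs = "\<lambda>_ \<omega>. fst (Zs 0 \<omega>)"])
      (use Z_lim in \<open>auto simp: marginals intro: tendsto_fst\<close>)
  then have fst_Z: "distr \<Omega> borel (\<lambda>\<omega>. fst (Z \<omega>)) = \<mu>" by (simp add: marginals)
  have snd_Z: "distr \<Omega> borel (\<lambda>\<omega>. snd (Z \<omega>)) = distr P borel X"
    by (rule distr_limit_unique[OF \<Omega> P, where Xs = "\<lambda>n \<omega>. snd (Zs n \<omega>)" and Zs = "\<lambda>n. Xs (r n)"])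
      (use Z_lim LIMSEQ_subseq_LIMSEQ[OF lim r] in \<open>auto simp: marginals o_def intro: tendsto_snd\<close>)
  have "distr \<Omega> borel Z \<in> couplings \<mu> (distr P borel X)"
    unfolding couplings_def using distr_in_borel_probs[OF \<Omega> Z] fst_Z snd_Z
    by (simp add: distr_distr o_def)
  then have "transport_cost (power_cost d p) \<mu> (distr P borel X) \<le> integral\<^sup>N (distr \<Omega> borel Z) ?c"
    unfolding transport_cost_def by (rule INF_lower)
  also have c_meas: "?c \<in> borel_measurable borel"
    unfolding power_cost_def by (rule meas(1))
  then have "integral\<^sup>N (distr \<Omega> borel Z) ?c = (\<integral>\<^sup>+ \<omega>. ?c (Z \<omega>) \<partial>\<Omega>)"
    by (intro nn_integral_distr) auto
  also have "\<dots> \<le> ennreal (a + 0)"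
  proof (rule nn_integral_le_of_liminf[where u = "\<lambda>n \<omega>. ?c (Zs n \<omega>)" and b = "\<lambda>n. ennreal (a + 1 / Suc (r n))"])
    show "(\<lambda>\<omega>. ?c (Zs n \<omega>)) \<in> borel_measurable \<Omega>" for n
      using c_meas by measurable
    show "?c (Z \<omega>) \<le> liminf (\<lambda>n. ?c (Zs n \<omega>))" if "\<omega> \<in> space \<Omega>" for \<omega>
    proof -
      have "continuous_on UNIV (\<lambda>z. power_cost d p (fst z) (snd z))"
        unfolding power_cost_def by (intro cost_cont continuous_intros)
      then have "(\<lambda>n. ?c (Zs n \<omega>)) \<longlonglongrightarrow> ?c (Z \<omega>)"
        using Z_lim[OF that] by (intro tendsto_ennrealI) (auto intro: continuous_on_tendsto_compose)
      then show ?thesis by (simp add: lim_imp_Liminf)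
    qed
    show "(\<integral>\<^sup>+ \<omega>. ?c (Zs n \<omega>) \<partial>\<Omega>) \<le> ennreal (a + 1 / Suc (r n))" for n
    proof -
      have "(\<integral>\<^sup>+ \<omega>. ?c (Zs n \<omega>) \<partial>\<Omega>) = integral\<^sup>N (distr \<Omega> borel (Zs n)) ?c"
        using c_meas by (intro nn_integral_distr[symmetric]) auto
      then show ?thesis using \<pi>_cost[of "r n"] by (simp add: distr_Zs)
    qed
    have "(\<lambda>n. 1 / real (Suc (r n))) \<longlonglongrightarrow> 0"
      using LIMSEQ_subseq_LIMSEQ[OF LIMSEQ_Suc[OF lim_1_over_n] r] by (simp add: o_def)
    then show "(\<lambda>n. ennreal (a + 1 / Suc (r n))) \<longlonglongrightarrow> ennreal (a + 0)"
      by (intro tendsto_ennrealI tendsto_add tendsto_const)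
  qed
  finally show ?thesis by simp
qed

subsection \<open>Upper semicontinuity of the objective\<close>

text \<open>All three facts come from the identity of nonnegative integrals
  of (C + e H - f) + max f 0 and (C + e H) + max (- f) 0, which needs no integrability of f.\<close>

lemma ext_integral_bounds:
  assumes P: "prob_space \<gamma>"
    and f[measurable]: "f \<in> borel_measurable \<gamma>" and H[measurable]: "H \<in> borel_measurable \<gamma>"
    and H_nonneg: "\<And>x. 0 \<le> H x"
    and EH: "(\<integral>\<^sup>+ x. ennreal (H x) \<partial>\<gamma>) \<le> ennreal B" and B: "0 \<le> B"
    and e: "0 < e" and C: "0 \<le> C"
    and f_le: "\<And>x. f x \<le> C + e * H x"
  shows "ereal l \<le> ext_integral \<gamma> f \<Longrightarrow> l \<le> C + e * B"
    and "ereal l \<le> ext_integral \<gamma> f \<Longrightarrow> (\<integral>\<^sup>+ x. ennreal (C + e * H x - f x) \<partial>\<gamma>) \<le> ennreal (C + e * B - l)"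
    and "(\<integral>\<^sup>+ x. ennreal (C + e * H x - f x) \<partial>\<gamma>) \<le> ennreal (C + e * B - l) \<Longrightarrow> l \<le> C + e * B \<Longrightarrow>
      ereal (l - e * B) \<le> ext_integral \<gamma> f"
proof -
  interpret prob_space \<gamma> by fact
  define E where "E = enn2real (\<integral>\<^sup>+ x. ennreal (H x) \<partial>\<gamma>)"
  have E: "(\<integral>\<^sup>+ x. ennreal (H x) \<partial>\<gamma>) = ennreal E" "0 \<le> E"
    unfolding E_def using EH by (cases "\<integral>\<^sup>+ x. ennreal (H x) \<partial>\<gamma>"; auto simp: top_unique)+
  have "E \<le> B" using EH E B by simp
  have CE: "(\<integral>\<^sup>+ x. ennreal (C + e * H x) \<partial>\<gamma>) = ennreal (C + e * E)"
  proof -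
    have "(\<integral>\<^sup>+ x. ennreal (C + e * H x) \<partial>\<gamma>) = (\<integral>\<^sup>+ x. ennreal C + ennreal e * ennreal (H x) \<partial>\<gamma>)"
      using C e H_nonneg by (intro nn_integral_cong) (simp add: ennreal_plus ennreal_mult)
    also have "\<dots> = ennreal C + ennreal e * ennreal E"
      by (simp add: nn_integral_add nn_integral_cmult E emeasure_space_1)
    finally show ?thesis using C e E(2) by (simp add: ennreal_plus ennreal_mult)
  qed
  have CE_nonneg: "0 \<le> C + e * E" using C e E(2) by simp
  have f_int: "(\<integral>\<^sup>+ x. ennreal (f x) \<partial>\<gamma>) \<le> ennreal (C + e * E)"
    unfolding CE[symmetric] by (intro nn_integral_mono ennreal_leI f_le)
  then obtain p where p: "(\<integral>\<^sup>+ x. ennreal (f x) \<partial>\<gamma>) = ennreal p" "0 \<le> p"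
    by (cases "\<integral>\<^sup>+ x. ennreal (f x) \<partial>\<gamma>") (auto simp: top_unique)
  have p_le: "p \<le> C + e * E"
    using f_int ennreal_le_iff[OF CE_nonneg] unfolding p(1) by blast
  define G where "G = (\<integral>\<^sup>+ x. ennreal (C + e * H x - f x) \<partial>\<gamma>)"
  define N where "N = (\<integral>\<^sup>+ x. ennreal (- f x) \<partial>\<gamma>)"
  have balance: "G + ennreal p = ennreal (C + e * E) + N"
  proof -
    have "G + ennreal p = (\<integral>\<^sup>+ x. ennreal (C + e * H x - f x) + ennreal (f x) \<partial>\<gamma>)"
      unfolding G_def p(1)[symmetric] by (rule nn_integral_add[symmetric]) measurable
    also have "\<dots> = (\<integral>\<^sup>+ x. ennreal (C + e * H x) + ennreal (- f x) \<partial>\<gamma>)"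
    proof (rule nn_integral_cong)
      fix x
      have "0 \<le> C + e * H x" using C e H_nonneg[of x] by simp
      then show "ennreal (C + e * H x - f x) + ennreal (f x) = ennreal (C + e * H x) + ennreal (- f x)"
        using f_le[of x] by (cases "0 \<le> f x") (simp_all add: ennreal_neg flip: ennreal_plus)
    qed
    also have "\<dots> = ennreal (C + e * E) + N"
      unfolding N_def CE[symmetric] by (rule nn_integral_add) measurable
    finally show ?thesis .
  qed
  have ext: "ext_integral \<gamma> f = ereal p - enn2ereal N"
    unfolding ext_integral_def p(1) N_def using p(2) by simp
  have eE: "e * E \<le> e * B" using \<open>E \<le> B\<close> e by simp
  show "l \<le> C + e * B" and "(\<integral>\<^sup>+ x. ennreal (C + e * H x - f x) \<partial>\<gamma>) \<le> ennreal (C + e * B - l)"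
    if l_le: "ereal l \<le> ext_integral \<gamma> f"
  proof -
    \<comment> \<open>An infinite negative part would make the extended integral minus infinity,
      contrary to the real lower bound \<open>l\<close>; \<open>balance\<close> then makes
      \<open>G\<close> finite too.\<close>
    obtain n where n: "N = ennreal n" "0 \<le> n"
      using l_le unfolding ext by (cases N) auto
    have l: "l \<le> p - n" using l_le unfolding ext n(1) using n(2) by simp
    then show "l \<le> C + e * B" using p_le n(2) eE by linarith
    obtain g where g: "G = ennreal g" "0 \<le> g"
      using balance ennreal_add_eq_top[of G "ennreal p"] ennreal_add_eq_top[of "ennreal (C + e * E)" "ennreal n"]
      unfolding n(1) by (cases G) (auto simp: ennreal_neq_top simp del: ennreal_plus)
    have "g + p = C + e * E + n"
      using balance p(2) n(2) g(2) CE_nonneg unfolding n(1) g(1) by (simp flip: ennreal_plus)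
    then have "g \<le> C + e * B - l" using l eE by linarith
    then show "(\<integral>\<^sup>+ x. ennreal (C + e * H x - f x) \<partial>\<gamma>) \<le> ennreal (C + e * B - l)"
      unfolding G_def[symmetric] g(1) by (rule ennreal_leI)
  qed
  show "ereal (l - e * B) \<le> ext_integral \<gamma> f"
    if G_le: "(\<integral>\<^sup>+ x. ennreal (C + e * H x - f x) \<partial>\<gamma>) \<le> ennreal (C + e * B - l)" and l: "l \<le> C + e * B"
  proof -
    \<comment> \<open>\<open>ennreal\<close> cuts negative reals off at 0; thanks to
      \<open>l \<le> C + e * B\<close> the bound on \<open>G\<close> can be read as one between
      reals.\<close>
    obtain g where g: "G = ennreal g" "0 \<le> g" "g \<le> C + e * B - l"
      using G_le l unfolding G_def[symmetric] by (cases G) (auto simp: top_unique)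
    obtain n where n: "N = ennreal n" "0 \<le> n"
      using balance unfolding g(1) by (cases N) auto
    have "g + p = C + e * E + n"
      using balance p(2) n(2) g(2) CE_nonneg unfolding n(1) g(1) by (simp flip: ennreal_plus)
    \<comment> \<open>The bound on \<open>G\<close> is stated with \<open>B\<close>, while nothing
      but \<open>0 \<le> E\<close> bounds the moment from below; this is the origin of the deficit
      \<open>e * B\<close>.\<close>
    moreover have "0 \<le> e * E" using e E(2) by simp
    ultimately have "l - e * B \<le> p - n" using g(3) by linarith
    then show ?thesis unfolding ext n(1) using n(2) by simp
  qed
qed

text \<open>Fatou controls \<open>C + e * H - f\<close>, but removing \<open>e * H\<close> again is
  not free: the integrals of \<open>H\<close> need not converge, and only the bound \<open>B\<close>
  survives in the limit. The error is at most \<open>e * B\<close>, with \<open>e\<close> at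
  choice.\<close>

lemma ext_integral_limit_ge:
  fixes f H :: "'a::topological_space \<Rightarrow> real"
  assumes P: "prob_space P"
    and Xs: "\<And>n. Xs n \<in> borel_measurable P" and X: "X \<in> borel_measurable P"
    and X_lim: "\<And>\<omega>. \<omega> \<in> space P \<Longrightarrow> (\<lambda>n. Xs n \<omega>) \<longlonglongrightarrow> X \<omega>"
    and f: "f \<in> borel_measurable borel" and usc: "upper_semicontinuous f"
    and H: "continuous_on UNIV H" and H_nonneg: "\<And>x. 0 \<le> H x"
    and growth: "\<And>e. 0 < e \<Longrightarrow> \<exists>C\<ge>0. \<forall>x. f x \<le> C + e * H x"
    and EH: "\<And>n. (\<integral>\<^sup>+ x. ennreal (H x) \<partial>distr P borel (Xs n)) \<le> ennreal B" and B: "0 \<le> B"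
    and low: "\<And>n. ereal (l n) \<le> ext_integral (distr P borel (Xs n)) f" and l: "l \<longlonglongrightarrow> L"
  shows "ereal L \<le> ext_integral (distr P borel X) f"
proof -
  have H_meas: "H \<in> borel_measurable borel"
    using H by (rule borel_measurable_continuous_onI)
  have H_lim: "(\<lambda>n. H (Xs n \<omega>)) \<longlonglongrightarrow> H (X \<omega>)" if "\<omega> \<in> space P" for \<omega>
    using continuous_on_tendsto_compose[OF H X_lim[OF that]] by simp
  have prob_X: "prob_space (distr P borel X)"
    using P X by (rule prob_space.prob_space_distr)
  have prob_Xs: "prob_space (distr P borel (Xs n))" for n
    using P Xs by (rule prob_space.prob_space_distr)
  have int_distr: "integral\<^sup>N (distr P borel Y) g = (\<integral>\<^sup>+ \<omega>. g (Y \<omega>) \<partial>P)"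
    if "Y \<in> borel_measurable P" "g \<in> borel_measurable borel" for Y and g :: "'a \<Rightarrow> ennreal"
    using that by (intro nn_integral_distr) auto
  have EH_X: "(\<integral>\<^sup>+ x. ennreal (H x) \<partial>distr P borel X) \<le> ennreal B"
    unfolding int_distr[OF X measurable_compose[OF H_meas measurable_ennreal]]
  proof (rule nn_integral_le_of_liminf[where u = "\<lambda>n \<omega>. ennreal (H (Xs n \<omega>))" and b = "\<lambda>_. ennreal B"])
    show "(\<lambda>\<omega>. ennreal (H (Xs n \<omega>))) \<in> borel_measurable P" for n
      using Xs[of n] H_meas by measurable
    show "ennreal (H (X \<omega>)) \<le> liminf (\<lambda>n. ennreal (H (Xs n \<omega>)))" if "\<omega> \<in> space P" for \<omega>
      using lim_imp_Liminf[OF sequentially_bot tendsto_ennrealI[OF H_lim[OF that]]] by simp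
    show "(\<integral>\<^sup>+ \<omega>. ennreal (H (Xs n \<omega>)) \<partial>P) \<le> ennreal B" for n
      using EH[of n] unfolding int_distr[OF Xs measurable_compose[OF H_meas measurable_ennreal]] .
  qed simp
  have approx: "ereal (L - e * B) \<le> ext_integral (distr P borel X) f" if e: "0 < e" for e
  proof -
    obtain C where C: "0 \<le> C" and f_le: "\<And>x. f x \<le> C + e * H x"
      using growth[OF e] by blast
    define g where "g x = C + e * H x - f x" for x
    have g_meas: "(\<lambda>x. ennreal (g x)) \<in> borel_measurable borel"
      unfolding g_def using H_meas f by measurable
    note bounds = ext_integral_bounds[OF prob_Xs _ _ H_nonneg EH B e C f_le, unfolded measurable_distr_eq1, OF f H_meas]
    have "(\<integral>\<^sup>+ \<omega>. ennreal (g (X \<omega>)) \<partial>P) \<le> ennreal (C + e * B - L)"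
    proof (rule nn_integral_le_of_liminf[where u = "\<lambda>n \<omega>. ennreal (g (Xs n \<omega>))" and b = "\<lambda>n. ennreal (C + e * B - l n)"])
      show "(\<lambda>\<omega>. ennreal (g (Xs n \<omega>))) \<in> borel_measurable P" for n
        using measurable_compose[OF Xs g_meas] .
      show "(\<integral>\<^sup>+ \<omega>. ennreal (g (Xs n \<omega>)) \<partial>P) \<le> ennreal (C + e * B - l n)" for n
        using bounds(2)[OF low[of n]] unfolding int_distr[OF Xs g_meas, symmetric] by (simp add: g_def)
      show "(\<lambda>n. ennreal (C + e * B - l n)) \<longlonglongrightarrow> ennreal (C + e * B - L)"
        by (intro tendsto_ennrealI tendsto_diff tendsto_const l)
      show "ennreal (g (X \<omega>)) \<le> liminf (\<lambda>n. ennreal (g (Xs n \<omega>)))" if "\<omega> \<in> space P" for \<omega>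
        unfolding le_Liminf_iff
      proof (intro allI impI)
        fix y assume y: "y < ennreal (g (X \<omega>))"
        then obtain s where s: "y = ennreal s" "0 \<le> s" by (cases y) auto
        with y have "s < g (X \<omega>)" by (simp add: ennreal_less_iff)
        \<comment> \<open>Half of the gap pays for a rise of \<open>f\<close>, the other half for a
          drop of \<open>e * H\<close>.\<close>
        define t where "t = (g (X \<omega>) - s) / 2"
        have "0 < t" unfolding t_def using \<open>s < g (X \<omega>)\<close> by simp
        have "eventually (\<lambda>x. f x < f (X \<omega>) + t) (nhds (X \<omega>))"
          using usc \<open>0 < t\<close> unfolding upper_semicontinuous_def by simp
        then have f_ev: "eventually (\<lambda>n. f (Xs n \<omega>) < f (X \<omega>) + t) sequentially"
          using X_lim[OF that] unfolding filterlim_iff by blast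
        have "(\<lambda>n. e * H (Xs n \<omega>)) \<longlonglongrightarrow> e * H (X \<omega>)"
          by (intro tendsto_mult tendsto_const H_lim that)
        then have "eventually (\<lambda>n. e * H (X \<omega>) - t < e * H (Xs n \<omega>)) sequentially"
          by (rule order_tendstoD) (use \<open>0 < t\<close> in simp)
        with f_ev show "eventually (\<lambda>n. y < ennreal (g (Xs n \<omega>))) sequentially"
        proof eventually_elim
          case (elim n)
          have "2 * t = g (X \<omega>) - s" unfolding t_def by simp
          then have "s < g (Xs n \<omega>)" using elim unfolding g_def by linarith
          then show ?case using s by (simp add: ennreal_less_iff)
        qed
      qed
    qed
    then have "(\<integral>\<^sup>+ x. ennreal (C + e * H x - f x) \<partial>distr P borel X) \<le> ennreal (C + e * B - L)"
      unfolding int_distr[OF X g_meas, symmetric] by (simp add: g_def)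
    moreover have "L \<le> C + e * B"
      using bounds(1)[OF low] by (intro LIMSEQ_le_const2[OF l]) blast
    ultimately show ?thesis
      using ext_integral_bounds(3)[OF prob_X _ _ H_nonneg EH_X B e C f_le, unfolded measurable_distr_eq1, OF f H_meas, of L]
      by blast
  qed
  show ?thesis
  proof (rule ereal_le_epsilon2)
    fix \<eta> :: real assume "0 < \<eta>"
    \<comment> \<open>The denominator \<open>B + 1\<close> is positive also for \<open>B = 0\<close>
      and gives \<open>e * B \<le> \<eta>\<close>.\<close>
    define e where "e = \<eta> / (B + 1)"
    have "0 < e" unfolding e_def using \<open>0 < \<eta>\<close> B by simp
    have "e * B \<le> \<eta>" unfolding e_def using \<open>0 < \<eta>\<close> B by (simp add: field_simps)
    then have "ereal L \<le> ereal (L - e * B) + ereal \<eta>" by simp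
    also have "\<dots> \<le> ext_integral (distr P borel X) f + ereal \<eta>"
      by (intro add_right_mono approx \<open>0 < e\<close>)
    finally show "ereal L \<le> ext_integral (distr P borel X) f + ereal \<eta>" .
  qed
qed

subsection \<open>Attainment of the supremum\<close>

lemma powr_le_add_powr:
  fixes p q e :: real
  assumes "0 < q" "q < p" "0 < e"
  obtains R where "0 \<le> R" and "\<And>t. 0 \<le> t \<Longrightarrow> t powr q \<le> R + e * t powr p"
proof
  \<comment> \<open>\<open>T\<close> is the point where \<open>e * t powr (p - q)\<close> reaches 1:
    beyond it the higher power dominates, before it \<open>t powr q\<close> is at most
    \<open>T powr q\<close>.\<close>
  define T where "T = (1 / e) powr (1 / (p - q))"
  show "0 \<le> T powr q" by simp
  fix t :: real assume "0 \<le> t"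
  show "t powr q \<le> T powr q + e * t powr p"
  proof (cases "t \<le> T")
    case True
    then have "t powr q \<le> T powr q"
      using \<open>0 \<le> t\<close> assms by (intro powr_mono2) auto
    moreover have "0 \<le> e * t powr p" using assms by simp
    ultimately show ?thesis by linarith
  next
    case False
    have "1 / e = T powr (p - q)"
      unfolding T_def using assms by (simp add: powr_powr)
    also have "\<dots> \<le> t powr (p - q)"
      using False assms by (intro powr_mono2) (auto simp: T_def)
    finally have "1 \<le> e * t powr (p - q)"
      using assms by (simp add: field_simps)
    then have "t powr q * 1 \<le> t powr q * (e * t powr (p - q))"
      by (intro mult_left_mono) auto
    also have "\<dots> = e * t powr p"
      by (simp flip: powr_add add: mult.left_commute)
    finally show ?thesis by (simp add: add_increasing)
  qed
qed

lemma moment_probsD: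
  assumes "\<mu> \<in> moment_probs d p"
  shows "\<mu> \<in> borel_probs"
  using assms unfolding moment_probs_def by simp

text \<open>\<open>moment_probs\<close> provides some base point, while the growth condition on
  \<open>f\<close> names its own; the triangle inequality moves the moment from one to the
  other.\<close>

lemma moment_finite:
  fixes d :: "'a::{metric_space, second_countable_topology} \<Rightarrow> 'a \<Rightarrow> real"
  assumes d: "proper_polish_metric d" and p: "0 < p" and \<mu>: "\<mu> \<in> moment_probs d p"
  shows "(\<integral>\<^sup>+ x. ennreal (d s x powr p) \<partial>\<mu>) < \<infinity>"
proof -
  interpret prob_space \<mu> using borel_probsD(1)[OF moment_probsD[OF \<mu>]] .
  obtain x0 where x0: "(\<integral>\<^sup>+ x. ennreal (d x0 x powr p) \<partial>\<mu>) < \<infinity>"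
    using \<mu> unfolding moment_probs_def by auto
  have meas: "(\<lambda>x. ennreal (d x0 x powr p)) \<in> borel_measurable \<mu>"
    using measurable_metric_powr(2)[OF d p]
      measurable_cong_sets[OF borel_probsD(2)[OF moment_probsD[OF \<mu>]] refl] by blast
  have "(\<integral>\<^sup>+ x. ennreal (d s x powr p) \<partial>\<mu>) \<le>
      (\<integral>\<^sup>+ x. ennreal (2 powr p) * (ennreal (d s x0 powr p) + ennreal (d x0 x powr p)) \<partial>\<mu>)"
  proof (rule nn_integral_mono)
    fix x
    have "d s x powr p \<le> (d s x0 + d x0 x) powr p"
      using p by (intro powr_mono2 proper_polish_metricD[OF d]) auto
    also have "\<dots> \<le> 2 powr p * (d s x0 powr p + d x0 x powr p)"
      using p by (intro powr_add_le proper_polish_metricD[OF d]) auto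
    finally show "ennreal (d s x powr p) \<le> ennreal (2 powr p) * (ennreal (d s x0 powr p) + ennreal (d x0 x powr p))"
      by (simp flip: ennreal_plus ennreal_mult'' add: ennreal_leI)
  qed
  also have "\<dots> = ennreal (2 powr p) * (ennreal (d s x0 powr p) + (\<integral>\<^sup>+ x. ennreal (d x0 x powr p) \<partial>\<mu>))"
    using meas by (simp add: nn_integral_cmult nn_integral_add emeasure_space_1)
  also have "\<dots> < \<infinity>"
    using x0 by (simp add: ennreal_mult_less_top)
  finally show ?thesis .
qed

text \<open>\<open>B\<close> is fixed before \<open>\<nu>\<close>, so the moments are bounded
  uniformly over the transport ball. A coupling of cost at most \<open>a + 1\<close> is good enough
  for that.\<close>

lemma transport_ball_moment_le:
  fixes d :: "'a::{metric_space, second_countable_topology} \<Rightarrow> 'a \<Rightarrow> real"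
  assumes d: "proper_polish_metric d" and p: "0 < p" and \<mu>: "\<mu> \<in> moment_probs d p" and a: "0 \<le> a"
  obtains B where "0 \<le> B"
    and "\<And>\<nu>. transport_cost (power_cost d p) \<mu> \<nu> \<le> ennreal a \<Longrightarrow> (\<integral>\<^sup>+ x. ennreal (d s x powr p) \<partial>\<nu>) \<le> ennreal B"
proof -
  obtain K where K: "(\<integral>\<^sup>+ x. ennreal (d s x powr p) \<partial>\<mu>) = ennreal K" "0 \<le> K"
    using moment_finite[OF d p \<mu>, of s] by (cases "\<integral>\<^sup>+ x. ennreal (d s x powr p) \<partial>\<mu>") auto
  show ?thesis
  proof
    show "0 \<le> 2 powr p * (K + (a + 1))" using K(2) a by simp
    fix \<nu> assume "transport_cost (power_cost d p) \<mu> \<nu> \<le> ennreal a"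
    then obtain \<pi> where \<pi>: "\<pi> \<in> couplings \<mu> \<nu>"
      and cost: "(\<integral>\<^sup>+ z. ennreal (power_cost d p (fst z) (snd z)) \<partial>\<pi>) \<le> ennreal (a + 1)"
      using exists_coupling_cost_le[OF _ a zero_less_one] by metis
    note coupling_moment_le[OF d p \<pi>, of s]
    also have "ennreal (2 powr p) * ((\<integral>\<^sup>+ x. ennreal (d s x powr p) \<partial>\<mu>) +
        (\<integral>\<^sup>+ z. ennreal (power_cost d p (fst z) (snd z)) \<partial>\<pi>)) \<le> ennreal (2 powr p) * (ennreal K + ennreal (a + 1))"
      unfolding K(1) using cost by (intro mult_left_mono add_left_mono) auto
    finally show "(\<integral>\<^sup>+ x. ennreal (d s x powr p) \<partial>\<nu>) \<le> ennreal (2 powr p * (K + (a + 1)))"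
      using K(2) a by (simp add: ennreal_mult ennreal_plus)
  qed
qed

text \<open>The diagonal coupling costs nothing. Hence \<open>\<nu>0\<close>, whose projections are
  \<open>\<mu>13\<close> and \<open>\<mu>23\<close>, is feasible for every pair of radii, 0
  included.\<close>

lemma transport_cost_self:
  fixes d :: "'a::{metric_space, second_countable_topology} \<Rightarrow> 'a \<Rightarrow> real"
  assumes d: "proper_polish_metric d" and p: "0 < p" and \<mu>: "\<mu> \<in> borel_probs"
  shows "transport_cost (power_cost d p) \<mu> \<mu> = 0"
proof -
  have diag: "(\<lambda>x. (x, x)) \<in> \<mu> \<rightarrow>\<^sub>M borel"
    unfolding measurable_cong_sets[OF borel_probsD(2)[OF \<mu>] refl]
    by (intro borel_measurable_continuous_onI continuous_intros)
  let ?\<pi> = "distr \<mu> borel (\<lambda>x. (x, x))"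
  have id: "distr \<mu> borel (\<lambda>x. x) = \<mu>"
    by (rule distr_id2) (rule borel_probsD(2)[OF \<mu>, symmetric])
  have "?\<pi> \<in> couplings \<mu> \<mu>"
    using distr_in_borel_probs[OF borel_probsD(1)[OF \<mu>] diag]
    by (simp add: couplings_def distr_distr[OF measurable_fst_snd_borel(1) diag]
        distr_distr[OF measurable_fst_snd_borel(2) diag] o_def id)
  then have "transport_cost (power_cost d p) \<mu> \<mu> \<le> (\<integral>\<^sup>+ z. ennreal (power_cost d p (fst z) (snd z)) \<partial>?\<pi>)"
    unfolding transport_cost_def by (rule INF_lower)
  also have "\<dots> = (\<integral>\<^sup>+ x. ennreal (power_cost d p x x) \<partial>\<mu>)"
    using measurable_metric_powr(1)[OF d p] by (subst nn_integral_distr[OF diag]) (simp_all add: power_cost_def)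
  also have "\<dots> = 0"
    using proper_polish_metricD(2)[OF d] by (simp add: power_cost_def)
  finally show ?thesis by simp
qed

theorem theorem4p4:
  fixes d1 :: "'y1::polish_space \<times> 'x::polish_space \<Rightarrow> 'y1 \<times> 'x \<Rightarrow> real"
    and d2 :: "'y2::polish_space \<times> 'x \<Rightarrow> 'y2 \<times> 'x \<Rightarrow> real"
    and p1 p2 :: real
    and \<mu>13 :: "('y1 \<times> 'x) measure"
    and \<mu>23 :: "('y2 \<times> 'x) measure"
    and f :: "'y1 \<times> 'y2 \<times> 'x \<Rightarrow> real"
  assumes "proper_polish_metric d1" and "proper_polish_metric d2"
    and "1 \<le> p1" and "1 \<le> p2"
    and "\<mu>13 \<in> moment_probs d1 p1" and "\<mu>23 \<in> moment_probs d2 p2"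
    and "distr \<mu>13 borel snd = distr \<mu>23 borel snd"
    and "f \<in> borel_measurable borel"
    and "\<exists>\<nu>0 \<in> overlapping_class \<mu>13 \<mu>23. ext_integral \<nu>0 f > -\<infinity>"
    and "upper_semicontinuous f"
    and "\<exists>s1 s2 M p1' p2'. M > 0 \<and> 0 < p1' \<and> p1' < p1 \<and> 0 < p2' \<and> p2' < p2 \<and>
           (\<forall>s. f s \<le> M * (1 + d1 s1 (pr13 s) powr p1' + d2 s2 (pr23 s) powr p2'))"
  shows "\<forall>\<delta> :: real ^ 2. (\<forall>i. 0 \<le> \<delta> $ i) \<longrightarrow>
           (\<exists>\<gamma> \<in> uncertainty_set (power_cost d1 p1) (power_cost d2 p2) \<mu>13 \<mu>23 \<delta>.
              ext_integral \<gamma> f =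
                (SUP \<gamma>' \<in> uncertainty_set (power_cost d1 p1) (power_cost d2 p2) \<mu>13 \<mu>23 \<delta>.
                   ext_integral \<gamma>' f))"
proof (intro allI impI)
  fix \<delta> :: "real ^ 2"
  assume "\<forall>i. 0 \<le> \<delta> $ i"
  then have \<delta>: "0 \<le> \<delta> $ 1" "0 \<le> \<delta> $ 2" by simp_all
  note d1 = assms(1) and d2 = assms(2)
  note f = assms(8)
  have p: "0 < p1" "0 < p2" using assms(3,4) by simp_all
  obtain \<nu>0 where \<nu>0: "\<nu>0 \<in> overlapping_class \<mu>13 \<mu>23" "ext_integral \<nu>0 f > -\<infinity>"
    using assms(9) by blast
  obtain s1 s2 M q1 q2 where M: "0 < M" and q: "0 < q1" "q1 < p1" "0 < q2" "q2 < p2"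
    and f_le: "\<And>s. f s \<le> M * (1 + d1 s1 (pr13 s) powr q1 + d2 s2 (pr23 s) powr q2)"
    using assms(11) by blast
  define U where "U = uncertainty_set (power_cost d1 p1) (power_cost d2 p2) \<mu>13 \<mu>23 \<delta>"
  define H where "H s = d1 s1 (pr13 s) powr p1 + d2 s2 (pr23 s) powr p2" for s
  have pr_cont: "continuous_on UNIV (pr13 :: 'y1 \<times> 'y2 \<times> 'x \<Rightarrow> _)" "continuous_on UNIV (pr23 :: 'y1 \<times> 'y2 \<times> 'x \<Rightarrow> _)"
    unfolding pr13_def pr23_def by (auto simp: case_prod_beta intro!: continuous_intros)
  note pr_meas = pr_cont[THEN borel_measurable_continuous_onI]
  have H_cont: "continuous_on UNIV H"
    unfolding H_def
    by (intro continuous_on_add continuous_on_metric_powr d1 d2 p continuous_on_const pr_cont)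
  have H_meas: "H \<in> borel_measurable borel"
    using H_cont by (rule borel_measurable_continuous_onI)
  have H_nonneg: "0 \<le> H s" for s unfolding H_def by simp
  have H_compact: "compact {s. H s \<le> r}" for r
  proof -
    let ?K = "{y. d1 s1 y powr p1 \<le> r} \<times> {y. d2 s2 y powr p2 \<le> r}"
    \<comment> \<open>\<open>?j\<close> recovers \<open>s\<close> from its two projections, reading
      the shared coordinate off the first. It is defined on all pairs, also those whose last
      coordinates disagree, so the image of a full product of compact sets covers the sublevel
      set.\<close>
    let ?j = "\<lambda>z :: ('y1 \<times> 'x) \<times> ('y2 \<times> 'x). (fst (fst z), fst (snd z), snd (fst z))"
    have "compact (?j ` ?K)"
      by (intro compact_continuous_image compact_Times compact_metric_powr_le d1 d2 p continuous_intros)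
    moreover have "{s. H s \<le> r} \<subseteq> ?j ` ?K"
    proof
      fix s assume s: "s \<in> {s. H s \<le> r}"
      have "d1 s1 (pr13 s) powr p1 \<le> H s" "d2 s2 (pr23 s) powr p2 \<le> H s"
        unfolding H_def by simp_all
      with s have K: "(pr13 s, pr23 s) \<in> ?K" by auto
      have "s = ?j (pr13 s, pr23 s)"
        by (simp add: pr13_def pr23_def split: prod.split)
      then show "s \<in> ?j ` ?K" by (rule rev_image_eqI[OF K])
    qed
    moreover have "closed {s. H s \<le> r}"
      by (intro closed_Collect_le H_cont continuous_on_const)
    ultimately show ?thesis by (rule compact_closed_subset)
  qed
  obtain B1 where B1: "0 \<le> B1" "\<And>\<nu>. transport_cost (power_cost d1 p1) \<mu>13 \<nu> \<le> ennreal (\<delta> $ 1) \<Longrightarrow>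
      (\<integral>\<^sup>+ x. ennreal (d1 s1 x powr p1) \<partial>\<nu>) \<le> ennreal B1"
    by (rule transport_ball_moment_le[OF d1 p(1) assms(5) \<delta>(1), of s1]) blast
  obtain B2 where B2: "0 \<le> B2" "\<And>\<nu>. transport_cost (power_cost d2 p2) \<mu>23 \<nu> \<le> ennreal (\<delta> $ 2) \<Longrightarrow>
      (\<integral>\<^sup>+ x. ennreal (d2 s2 x powr p2) \<partial>\<nu>) \<le> ennreal B2"
    by (rule transport_ball_moment_le[OF d2 p(2) assms(6) \<delta>(2), of s2]) blast
  define B where "B = B1 + B2"
  have "0 \<le> B" unfolding B_def using B1(1) B2(1) by simp
  have U_probs: "\<gamma> \<in> borel_probs" if "\<gamma> \<in> U" for \<gamma>
    using that unfolding U_def uncertainty_set_def by simp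
  have U_meas: "g \<in> \<gamma> \<rightarrow>\<^sub>M N" if "\<gamma> \<in> U" "g \<in> borel \<rightarrow>\<^sub>M N" for \<gamma> g and N :: "'z measure"
    using that(2) measurable_cong_sets[OF borel_probsD(2)[OF U_probs[OF that(1)]] refl] by blast
  have EH: "(\<integral>\<^sup>+ s. ennreal (H s) \<partial>\<gamma>) \<le> ennreal B" if \<gamma>: "\<gamma> \<in> U" for \<gamma>
  proof -
    have pr: "pr13 \<in> \<gamma> \<rightarrow>\<^sub>M borel" "pr23 \<in> \<gamma> \<rightarrow>\<^sub>M borel"
        by (rule U_meas[OF \<gamma> pr_meas(1)], rule U_meas[OF \<gamma> pr_meas(2)])
    note meas = measurable_metric_powr(2)[OF d1 p(1), of s1] measurable_metric_powr(2)[OF d2 p(2), of s2]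
    have "(\<integral>\<^sup>+ s. ennreal (H s) \<partial>\<gamma>) =
        (\<integral>\<^sup>+ s. ennreal (d1 s1 (pr13 s) powr p1) \<partial>\<gamma>) + (\<integral>\<^sup>+ s. ennreal (d2 s2 (pr23 s) powr p2) \<partial>\<gamma>)"
      unfolding H_def ennreal_plus[OF powr_ge_zero powr_ge_zero]
      by (intro nn_integral_add measurable_compose[OF pr(1) meas(1)] measurable_compose[OF pr(2) meas(2)])
    also have "\<dots> = (\<integral>\<^sup>+ x. ennreal (d1 s1 x powr p1) \<partial>distr \<gamma> borel pr13) +
        (\<integral>\<^sup>+ x. ennreal (d2 s2 x powr p2) \<partial>distr \<gamma> borel pr23)"
      using nn_integral_distr[OF pr(1), of "\<lambda>x. ennreal (d1 s1 x powr p1)"]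
        nn_integral_distr[OF pr(2), of "\<lambda>x. ennreal (d2 s2 x powr p2)"] meas by simp
    also have "\<dots> \<le> ennreal B1 + ennreal B2"
      using \<gamma> unfolding U_def uncertainty_set_def by (intro add_mono B1(2) B2(2)) auto
    also have "\<dots> = ennreal B"
      unfolding B_def using B1(1) B2(1) by (simp add: ennreal_plus)
    finally show ?thesis .
  qed
  have growth: "\<exists>C\<ge>0. \<forall>s. f s \<le> C + e * H s" if "0 < e" for e
  proof -
    \<comment> \<open>The factor \<open>M\<close> of the growth bound multiplies both powers, so
      each is absorbed at rate \<open>e / M\<close>; the remainders collect in
      \<open>M * (1 + R1 + R2)\<close>.\<close>
    obtain R1 where R1: "0 \<le> R1" "\<And>t. 0 \<le> t \<Longrightarrow> t powr q1 \<le> R1 + e / M * t powr p1"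
      using powr_le_add_powr[OF q(1,2), of "e / M"] \<open>0 < e\<close> M by (metis divide_pos_pos)
    obtain R2 where R2: "0 \<le> R2" "\<And>t. 0 \<le> t \<Longrightarrow> t powr q2 \<le> R2 + e / M * t powr p2"
      using powr_le_add_powr[OF q(3,4), of "e / M"] \<open>0 < e\<close> M by (metis divide_pos_pos)
    have "f s \<le> M * (1 + R1 + R2) + e * H s" for s
    proof -
      have "1 + d1 s1 (pr13 s) powr q1 + d2 s2 (pr23 s) powr q2 \<le> 1 + R1 + R2 + e / M * H s"
        using R1(2)[OF proper_polish_metricD(1)[OF d1, of s1 "pr13 s"]]
          R2(2)[OF proper_polish_metricD(1)[OF d2, of s2 "pr23 s"]]
        unfolding H_def by (simp add: distrib_left)
      then have "M * (1 + d1 s1 (pr13 s) powr q1 + d2 s2 (pr23 s) powr q2) \<le> M * (1 + R1 + R2 + e / M * H s)"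
        using M by (intro mult_left_mono) auto
      also have "\<dots> = M * (1 + R1 + R2) + e * H s"
        using M by (simp add: field_simps)
      finally show ?thesis using f_le[of s] by linarith
    qed
    moreover have "0 \<le> M * (1 + R1 + R2)" using M R1(1) R2(1) by simp
    ultimately show ?thesis by blast
  qed
  \<comment> \<open>A single choice of \<open>e\<close> bounds the objective on all of
    \<open>U\<close>; together with the value at \<open>\<nu>0\<close> this makes the supremum a
    real number \<open>L\<close>, so that the levels \<open>L - 1 / Suc n\<close> make
    sense.\<close>
  obtain C where C: "0 \<le> C" "\<And>s. f s \<le> C + 1 * H s"
    using growth[of 1] by auto
  have ext_le: "ext_integral \<gamma> f \<le> ereal (C + B)" if \<gamma>: "\<gamma> \<in> U" for \<gamma>
  proof (rule ccontr)
    assume "\<not> ext_integral \<gamma> f \<le> ereal (C + B)"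
    \<comment> \<open>\<open>ext_integral_bounds\<close> speaks about real levels, so a real number
      is put strictly between the two extended values.\<close>
    then obtain l where l: "ereal (C + B) < ereal l" "ereal l < ext_integral \<gamma> f"
      using ereal_dense2 by (metis not_le)
    have "l \<le> C + 1 * B"
      using borel_probsD(1)[OF U_probs[OF \<gamma>]] U_meas[OF \<gamma> f] U_meas[OF \<gamma> H_meas] H_nonneg EH[OF \<gamma>] \<open>0 \<le> B\<close>
        zero_less_one C
      by (rule ext_integral_bounds(1)) (use l(2) in simp)
    with l(1) show False by simp
  qed
  have \<nu>0_U: "\<nu>0 \<in> U"
    using \<nu>0(1) transport_cost_self[OF d1 p(1) moment_probsD[OF assms(5)]]
      transport_cost_self[OF d2 p(2) moment_probsD[OF assms(6)]]
    unfolding U_def uncertainty_set_def overlapping_class_def by simp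
  define S where "S = (SUP \<gamma>\<in>U. ext_integral \<gamma> f)"
  have "S \<le> ereal (C + B)"
    unfolding S_def by (intro SUP_least ext_le)
  moreover have "-\<infinity> < S"
    using \<nu>0(2) SUP_upper[OF \<nu>0_U, of "\<lambda>\<gamma>. ext_integral \<gamma> f"] unfolding S_def by (rule less_le_trans)
  ultimately obtain L where L: "S = ereal L" by (cases S) auto
  have "\<exists>\<gamma>\<in>U. ereal (L - 1 / Suc n) < ext_integral \<gamma> f" for n
  proof -
    have "ereal (L - 1 / Suc n) < S" unfolding L by simp
    then show ?thesis unfolding S_def less_SUP_iff .
  qed
  then obtain \<gamma> where \<gamma>: "\<And>n. \<gamma> n \<in> U" and \<gamma>_low: "\<And>n. ereal (L - 1 / Suc n) < ext_integral (\<gamma> n) f"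
    by metis
  obtain r and \<Omega> :: "real measure" and Xs X where r: "strict_mono (r :: nat \<Rightarrow> nat)"
    and \<Omega>: "prob_space \<Omega>"
    and Xs: "\<And>n. Xs n \<in> borel_measurable \<Omega>"
    and distr_Xs: "\<And>n. distr \<Omega> borel (Xs n) = \<gamma> (r n)"
    and X: "X \<in> borel_measurable \<Omega>"
    and X_lim: "\<And>\<omega>. \<omega> \<in> space \<Omega> \<Longrightarrow> (\<lambda>n. Xs n \<omega>) \<longlonglongrightarrow> X \<omega>"
    by (rule exists_convergent_representation[where \<gamma> = \<gamma>, OF H_meas H_nonneg H_compact U_probs[OF \<gamma>] EH[OF \<gamma>]]) blast
  have distr_pr: "distr \<Omega> borel (\<lambda>\<omega>. pr13 (Y \<omega>)) = distr (distr \<Omega> borel Y) borel pr13"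
    "distr \<Omega> borel (\<lambda>\<omega>. pr23 (Y \<omega>)) = distr (distr \<Omega> borel Y) borel pr23"
    if "Y \<in> borel_measurable \<Omega>" for Y :: "real \<Rightarrow> 'y1 \<times> 'y2 \<times> 'x"
    by (simp_all add: distr_distr[OF pr_meas(1) that] distr_distr[OF pr_meas(2) that] o_def)
  \<comment> \<open>The projections are continuous, so \<open>pr13 (Xs n \<omega>)\<close> and
    \<open>pr23 (Xs n \<omega>)\<close> converge pointwise, and each transport constraint is closed
    under such limits.\<close>
  have "distr \<Omega> borel X \<in> U"
  proof -
    have "transport_cost (power_cost d1 p1) \<mu>13 (distr \<Omega> borel (\<lambda>\<omega>. pr13 (X \<omega>))) \<le> ennreal (\<delta> $ 1)"
    proof (rule transport_cost_limit_le[OF d1 assms(3,5) \<Omega>, where Xs = "\<lambda>n \<omega>. pr13 (Xs n \<omega>)"])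
      show "(\<lambda>n. pr13 (Xs n \<omega>)) \<longlonglongrightarrow> pr13 (X \<omega>)" if "\<omega> \<in> space \<Omega>" for \<omega>
        using continuous_on_tendsto_compose[OF pr_cont(1) X_lim[OF that]] by simp
      show "transport_cost (power_cost d1 p1) \<mu>13 (distr \<Omega> borel (\<lambda>\<omega>. pr13 (Xs n \<omega>))) \<le> ennreal (\<delta> $ 1)" for n
        using \<gamma>[of "r n"] unfolding distr_pr[OF Xs] distr_Xs U_def uncertainty_set_def by simp
    qed (use \<delta> measurable_compose[OF Xs pr_meas(1)] measurable_compose[OF X pr_meas(1)] in auto)
    moreover have "transport_cost (power_cost d2 p2) \<mu>23 (distr \<Omega> borel (\<lambda>\<omega>. pr23 (X \<omega>))) \<le> ennreal (\<delta> $ 2)"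
    proof (rule transport_cost_limit_le[OF d2 assms(4,6) \<Omega>, where Xs = "\<lambda>n \<omega>. pr23 (Xs n \<omega>)"])
      show "(\<lambda>n. pr23 (Xs n \<omega>)) \<longlonglongrightarrow> pr23 (X \<omega>)" if "\<omega> \<in> space \<Omega>" for \<omega>
        using continuous_on_tendsto_compose[OF pr_cont(2) X_lim[OF that]] by simp
      show "transport_cost (power_cost d2 p2) \<mu>23 (distr \<Omega> borel (\<lambda>\<omega>. pr23 (Xs n \<omega>))) \<le> ennreal (\<delta> $ 2)" for n
        using \<gamma>[of "r n"] unfolding distr_pr[OF Xs] distr_Xs U_def uncertainty_set_def by simp
    qed (use \<delta> measurable_compose[OF Xs pr_meas(2)] measurable_compose[OF X pr_meas(2)] in auto)
    ultimately show ?thesis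
      using distr_in_borel_probs[OF \<Omega> X] unfolding distr_pr[OF X] U_def uncertainty_set_def by simp
  qed
  moreover have "ereal L \<le> ext_integral (distr \<Omega> borel X) f"
  proof (rule ext_integral_limit_ge[OF \<Omega> Xs X X_lim f assms(10) H_cont H_nonneg growth _ \<open>0 \<le> B\<close>])
    show "(\<integral>\<^sup>+ s. ennreal (H s) \<partial>distr \<Omega> borel (Xs n)) \<le> ennreal B" for n
      unfolding distr_Xs by (rule EH[OF \<gamma>])
    show "ereal (L - 1 / Suc (r n)) \<le> ext_integral (distr \<Omega> borel (Xs n)) f" for n
      unfolding distr_Xs using \<gamma>_low[of "r n"] by (rule less_imp_le)
    have "(\<lambda>n. L - 1 / real (Suc (r n))) \<longlonglongrightarrow> L - 0"
      using LIMSEQ_subseq_LIMSEQ[OF LIMSEQ_Suc[OF lim_1_over_n] r]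
      by (intro tendsto_diff tendsto_const) (simp add: o_def)
    then show "(\<lambda>n. L - 1 / real (Suc (r n))) \<longlonglongrightarrow> L" by simp
  qed
  ultimately show "\<exists>\<gamma>\<in>uncertainty_set (power_cost d1 p1) (power_cost d2 p2) \<mu>13 \<mu>23 \<delta>.
      ext_integral \<gamma> f = (SUP \<gamma>'\<in>uncertainty_set (power_cost d1 p1) (power_cost d2 p2) \<mu>13 \<mu>23 \<delta>. ext_integral \<gamma>' f)"
    using SUP_upper[of "distr \<Omega> borel X" U "\<lambda>\<gamma>. ext_integral \<gamma> f"] L
    unfolding U_def[symmetric] S_def by (intro bexI[of _ "distr \<Omega> borel X"] antisym) auto
qed

end
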